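(* Let $d\in\mathbb N$ and $M\subseteq\mathbb R^d$. The set $E_{\in M}:=\{X\in C^{2^-\text{-var}}(\mathbb R^d)\mid X:[0,T]\to\mathbb R^d,\ X_T-X_0\in M\}$ of paths with increment in $M$ is a path variety if and only if $M$ is a point variety.
   Context: For $d\in\mathbb N$, $C^{2^-\text{-var}}(\mathbb R^d)$ is the set of all continuous $X:[0,T]\to\mathbb R^d$, with $T\in(0,\infty)$ depending on $X$, that have finite $p$-variation for some $p\in[1,2)$, i.e. $\|X\|_{p\text{-var}}=\big(\sup_P\sum_{[s,t]\in P}\|X_t-X_s\|_2^p\big)^{1/p}<\infty$ (supremum over partitions $P$ of $[0,T]$). Its elements are called paths. $T(\mathbb R^d)=\bigoplus_{n\ge0}(\mathbb R^d)^{\otimes n}$ is identified with the real vector space spanned by the words in the letters $1,\dots,d$, including the empty word $\mathsf e$; $T((\mathbb R^d))$ is its linear dual (infinite formal series of words). The signature $\sigma(X)\in T((\mathbb R^d))$ of a path $X$ with components $X^{[i]}$ is given by $\langle\sigma(X),\mathsf e\rangle=1$ and the iterated Riemann–Stieltjes integrals $\langle\sigma(X),i_1\cdots i_n\rangle=\int_{0<t_1<\dots<t_n<T}dX^{[i_1]}_{t_1}\cdots dX^{[i_n]}_{t_n}$. A path variety is a set of the form $\mathcal V(W)=\{X\in C^{2^-\text{-var}}(\mathbb R^d)\mid\langle\sigma(X),x\rangle=0\ \forall x\in W\}$ with $W\subseteq T(\mathbb R^d)$. A point variety in $\mathbb R^d$ is the common zero set in $\mathbb R^d$ of a set of real polynomials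 in $d$ variables. *)

theory Defs
  imports "HOL-Analysis.Analysis" "HOL-Library.Poly_Mapping"
begin

section \<open>Paths of finite \<open>p\<close>-variation with \<open>p < 2\<close>\<close>

text \<open>A path \<open>X : [0,T] \<rightarrow> \<real>\<^sup>d\<close> is the pair \<open>(T, X)\<close>. As \<open>X\<close> is a total function
  in HOL, it is required to be \<open>extensional\<close>, so that equality of pairs is equality of
  functions on \<open>[0,T]\<close>.\<close>

type_synonym 'd path = "real \<times> (real \<Rightarrow> real ^ 'd)"

text \<open>A member \<open>K = {s..t}\<close> of a division contributes the increment \<open>X t - X s\<close>; the
  degenerate members \<open>{s..s}\<close> permitted by \<open>division_of\<close> contribute 0. The outer exponent
  \<open>1/p\<close> of the \<open>p\<close>-variation norm is omitted, since only finiteness is at stake.\<close>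

definition finite_p_variation :: "real \<Rightarrow> real \<Rightarrow> (real \<Rightarrow> 'a::real_normed_vector) \<Rightarrow> bool" where
  "finite_p_variation p T X \<longleftrightarrow>
     bdd_above ((\<lambda>P. \<Sum>K\<in>P. norm (X (Sup K) - X (Inf K)) powr p) ` {P. P division_of {0..T}})"

definition paths :: "('d::finite) path set" where
  "paths = {(T, X). 0 < T \<and> X \<in> extensional {0..T} \<and> continuous_on {0..T} X \<and>
                    (\<exists>p. 1 \<le> p \<and> p < 2 \<and> finite_p_variation p T X)}"

section \<open>The signature\<close>

text \<open>The Riemann--Stieltjes integral is the limit of \<open>\<Sum> f(x) (g(t) - g(s))\<close> over tagged
  divisions of \<open>[a,b]\<close>, with tag \<open>x \<in> [s,t]\<close>, as the mesh tends to 0.\<close>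

definition has_RS_integral ::
    "(real \<Rightarrow> real) \<Rightarrow> (real \<Rightarrow> real) \<Rightarrow> real \<Rightarrow> real \<Rightarrow> real \<Rightarrow> bool" where
  "has_RS_integral f g a b I \<longleftrightarrow>
     (\<forall>\<epsilon>>0. \<exists>\<delta>>0. \<forall>D. D tagged_division_of {a..b} \<and> (\<forall>(x, K)\<in>D. Sup K - Inf K < \<delta>) \<longrightarrow>
        \<bar>(\<Sum>(x, K)\<in>D. f x * (g (Sup K) - g (Inf K))) - I\<bar> < \<epsilon>)"

definition RS_integral :: "(real \<Rightarrow> real) \<Rightarrow> (real \<Rightarrow> real) \<Rightarrow> real \<Rightarrow> real \<Rightarrow> real" where
  "RS_integral f g a b = (THE I. has_RS_integral f g a b I)"

text \<open>Words are lists of letters from the index type \<open>'d\<close>; elements of \<open>T(\<real>\<^sup>d)\<close> are finitely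
  supported functions on words, elements of \<open>T((\<real>\<^sup>d))\<close> arbitrary functions on words.\<close>

type_synonym 'd tensor = "'d list \<Rightarrow>\<^sub>0 real"
type_synonym 'd tensor_series = "'d list \<Rightarrow> real"

text \<open>The word is read from its last letter, which belongs to the outermost integration
  variable: \<open>iterated_integral X [i\<^sub>n, \<dots>, i\<^sub>1] t\<close> integrates \<open>dX\<close> with components
  \<open>i\<^sub>1, \<dots>, i\<^sub>n\<close> in this order over \<open>0 < t\<^sub>1 < \<dots> < t\<^sub>n < t\<close>.\<close>

primrec iterated_integral :: "(real \<Rightarrow> real ^ 'd) \<Rightarrow> 'd list \<Rightarrow> real \<Rightarrow> real" where
  "iterated_integral X [] t = 1"
| "iterated_integral X (i # w) t = RS_integral (iterated_integral X w) (\<lambda>s. X s $ i) 0 t"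

fun signature :: "('d::finite) path \<Rightarrow> 'd tensor_series" where
  "signature (T, X) w = iterated_integral X (rev w) T"

definition pairing :: "'d tensor_series \<Rightarrow> 'd tensor \<Rightarrow> real" where
  "pairing a x = (\<Sum>w\<in>Poly_Mapping.keys x. Poly_Mapping.lookup x w * a w)"

section \<open>Path varieties and point varieties\<close>

definition path_zero_set :: "('d::finite) tensor set \<Rightarrow> 'd path set" where
  "path_zero_set W = {X \<in> paths. \<forall>x\<in>W. pairing (signature X) x = 0}"

definition path_variety :: "('d::finite) path set \<Rightarrow> bool" where
  "path_variety S \<longleftrightarrow> (\<exists>W. S = path_zero_set W)"

text \<open>Real polynomials in the variables indexed by \<open>'d\<close>: finitely supported coefficient
  functions on exponent vectors.\<close>

type_synonym 'd mpolynomial = "('d \<Rightarrow>\<^sub>0 nat) \<Rightarrow>\<^sub>0 real"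

definition mpoly_eval :: "('d::finite) mpolynomial \<Rightarrow> real ^ 'd \<Rightarrow> real" where
  "mpoly_eval f v =
     (\<Sum>m\<in>Poly_Mapping.keys f. Poly_Mapping.lookup f m * (\<Prod>i\<in>UNIV. (v $ i) ^ Poly_Mapping.lookup m i))"

definition point_variety :: "(real ^ 'd::finite) set \<Rightarrow> bool" where
  "point_variety M \<longleftrightarrow> (\<exists>F. M = {v. \<forall>f\<in>F. mpoly_eval f v = 0})"

definition paths_with_increment_in :: "(real ^ 'd::finite) set \<Rightarrow> 'd path set" where
  "paths_with_increment_in M = {(T, X) \<in> paths. X T - X 0 \<in> M}"

end

theory Submission
  imports Defs
begin

text \<open>A path of finite \<open>p\<close>-variation, \<open>p < 2\<close>, satisfies \<open>\<bar>X t - X s\<bar> \<le> c (V t - V s)\<^sup>\<alpha>\<close> for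
  a monotone \<open>V\<close> and \<open>\<alpha> > 1/2\<close>. Hence products of two increments are \<open>o(V t - V s)\<close>, the
  iterated integrals exist by sewing, and the product rule holds: the increment of the \<open>i\<close>-th
  component times the coefficient of a word is the sum of the coefficients of all words that
  arise by inserting \<open>i\<close>. So every polynomial in the increment is the pairing of the
  signature with a tensor, which makes \<open>E\<^sub>\<in>\<^sub>M\<close> a path variety when \<open>M\<close> is a point variety.
  Conversely, the signature of the straight path with increment \<open>v\<close> is polynomial in \<open>v\<close>,
  so that a path variety \<open>E\<^sub>\<in>\<^sub>M\<close> restricts to polynomial equations for \<open>M\<close>.\<close>

section \<open>Sewing\<close>

text \<open>The partition is cut at the last point up to which at most half of the total variation of
  \<open>v\<close> has accumulated. Both remaining pieces carry at most half of it, so that the constant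
  \<open>C\<close> has to satisfy \<open>2 C 2\<^sup>-\<^sup>\<theta> + 2 \<le> C\<close>.\<close>

lemma discrete_sewing:
  fixes v :: "nat \<Rightarrow> real" and \<xi> :: "nat \<Rightarrow> nat \<Rightarrow> real"
  assumes "1 < \<theta>" "0 \<le> \<epsilon>" "m \<le> n"
    and "\<And>i j. m \<le> i \<Longrightarrow> i \<le> j \<Longrightarrow> j \<le> n \<Longrightarrow> v i \<le> v j"
    and "\<And>i. m \<le> i \<Longrightarrow> i \<le> n \<Longrightarrow> \<xi> i i = 0"
    and "\<And>i j k. m \<le> i \<Longrightarrow> i \<le> j \<Longrightarrow> j \<le> k \<Longrightarrow> k \<le> n \<Longrightarrow>
           \<bar>\<xi> i k - \<xi> i j - \<xi> j k\<bar> \<le> \<epsilon> * (v k - v i) powr \<theta>"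
  shows "\<bar>(\<Sum>i=m..<n. \<xi> i (Suc i)) - \<xi> m n\<bar>
           \<le> 2 / (1 - 2 powr (1 - \<theta>)) * \<epsilon> * (v n - v m) powr \<theta>"
  using assms(3-)
proof (induction "n - m" arbitrary: m n rule: less_induct)
  case less
  define C where "C = 2 / (1 - 2 powr (1 - \<theta>))"
  have "2 powr (1 - \<theta>) < (2::real) powr 0"
    using \<open>1 < \<theta>\<close> by (subst powr_less_cancel_iff) auto
  then have "C * (1 - 2 powr (1 - \<theta>)) = 2" "C > 0"
    by (auto simp: C_def divide_eq_eq)
  then have C: "C * 2 powr (1 - \<theta>) + 2 = C" "C > 0"
    by (auto simp: algebra_simps)
  show ?case
  proof (cases "m = n")
    case True
    then show ?thesis using less.prems(3)[of n] by simp
  next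
    case False
    with less.prems have mn: "m < n" by simp
    define w where "w = v n - v m"
    define J where "J = {j \<in> {m..<n}. v j - v m \<le> w / 2}"
    have w: "w \<ge> 0" using less.prems(2)[of m n] mn by (simp add: w_def)
    have J: "finite J" "m \<in> J" using mn w by (auto simp: J_def)
    define j where "j = Max J"
    have jJ: "j \<in> J" unfolding j_def using J by (intro Max_in) auto
    then have j: "m \<le> j" "j < n" "v j - v m \<le> w / 2" by (auto simp: J_def)
    have j': "v n - v (Suc j) \<le> w / 2"
    proof (cases "Suc j = n")
      case True then show ?thesis using w by simp
    next
      \<comment> \<open>Maximality of \<open>j\<close> puts \<open>Suc j\<close> outside
        \<open>J\<close>, so more than half of the variation lies before
        \<open>Suc j\<close>.\<close>
      case False
      have "Suc j \<notin> J" using Max_ge[OF J(1), of "Suc j"] by (auto simp: j_def)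
      then show ?thesis using j False by (auto simp: J_def w_def field_simps)
    qed
    have half: "(w / 2) powr \<theta> = w powr \<theta> * 2 powr (- \<theta>)"
      using w by (simp add: powr_divide powr_minus_divide)
    have bnd: "C * \<epsilon> * x powr \<theta> \<le> C * \<epsilon> * (w powr \<theta> * 2 powr (- \<theta>))" if "0 \<le> x" "x \<le> w / 2" for x
      unfolding half[symmetric] using that C assms(1,2)
      by (intro mult_left_mono powr_mono2) auto
    \<comment> \<open>The cell from \<open>j\<close> to \<open>Suc j\<close> may carry most of the
      variation, but it is itself a summand and causes no error. The errors are those of the two
      outer pieces and of the two splittings of \<open>\<xi> m n\<close>, at \<open>j\<close> and at
      \<open>Suc j\<close>.\<close>
    have 1: "\<bar>(\<Sum>i=m..<j. \<xi> i (Suc i)) - \<xi> m j\<bar> \<le> C * \<epsilon> * (v j - v m) powr \<theta>"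
      unfolding C_def using j by (intro less.hyps less.prems) auto
    have 2: "\<bar>(\<Sum>i=Suc j..<n. \<xi> i (Suc i)) - \<xi> (Suc j) n\<bar> \<le> C * \<epsilon> * (v n - v (Suc j)) powr \<theta>"
      unfolding C_def using j by (intro less.hyps less.prems) auto
    have 3: "\<bar>\<xi> m n - \<xi> m j - \<xi> j n\<bar> \<le> \<epsilon> * w powr \<theta>"
      unfolding w_def using j by (intro less.prems) auto
    have 4: "\<bar>\<xi> j n - \<xi> j (Suc j) - \<xi> (Suc j) n\<bar> \<le> \<epsilon> * (v n - v j) powr \<theta>"
      using j by (intro less.prems) auto
    have 5: "\<epsilon> * (v n - v j) powr \<theta> \<le> \<epsilon> * w powr \<theta>"
      using j assms(1,2) less.prems(2)[of m j] less.prems(2)[of j n]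
      by (intro mult_left_mono powr_mono2) (auto simp: w_def)
    have split: "(\<Sum>i=m..<n. \<xi> i (Suc i)) = (\<Sum>i=m..<j. \<xi> i (Suc i)) + \<xi> j (Suc j) + (\<Sum>i=Suc j..<n. \<xi> i (Suc i))"
      using j by (simp add: sum.atLeastLessThan_concat[symmetric, of m j n] sum.atLeast_Suc_lessThan[of j n])
    have "\<bar>(\<Sum>i=m..<n. \<xi> i (Suc i)) - \<xi> m n\<bar>
        \<le> 2 * (C * \<epsilon> * (w powr \<theta> * 2 powr (- \<theta>))) + 2 * (\<epsilon> * w powr \<theta>)"
      using 1 2 3 4 5 bnd[OF _ j(3)] bnd[OF _ j'] less.prems(2)[of m j] less.prems(2)[of "Suc j" n] j
      unfolding split by auto
    also have "\<dots> = \<epsilon> * w powr \<theta> * (C * (2 * 2 powr (- \<theta>)) + 2)"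
      by (simp add: algebra_simps)
    also have "2 * 2 powr (- \<theta>) = (2::real) powr (1 - \<theta>)"
      by (simp add: powr_diff powr_minus_divide)
    also have "\<epsilon> * w powr \<theta> * (C * 2 powr (1 - \<theta>) + 2) = C * \<epsilon> * w powr \<theta>"
      using C by simp
    finally show ?thesis by (simp add: C_def w_def)
  qed
qed

text \<open>On a finite set of points, partial sums over its enumeration satisfy the required bounds by
  the discrete case; compactness of a product of intervals then yields one \<open>F\<close> for all points.
  The bound is local (any \<open>\<epsilon>\<close> admissible on \<open>[s,t]\<close> may be used there), because the
  identification of \<open>F\<close> as a Riemann--Stieltjes integral needs \<open>\<epsilon> \<rightarrow> 0\<close> as \<open>t - s \<rightarrow> 0\<close>.\<close>

theorem sewing:
  fixes V :: "real \<Rightarrow> real" and \<Xi> :: "real \<Rightarrow> real \<Rightarrow> real"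
  assumes "1 < \<theta>" "a \<le> b" and V: "mono_on {a..b} V"
    and diag: "\<And>s. a \<le> s \<Longrightarrow> s \<le> b \<Longrightarrow> \<Xi> s s = 0"
    and "0 \<le> K"
    and K: "\<And>s u t. a \<le> s \<Longrightarrow> s \<le> u \<Longrightarrow> u \<le> t \<Longrightarrow> t \<le> b \<Longrightarrow>
              \<bar>\<Xi> s t - \<Xi> s u - \<Xi> u t\<bar> \<le> K * (V t - V s) powr \<theta>"
  obtains F where
    "\<And>s t \<epsilon>. a \<le> s \<Longrightarrow> s \<le> t \<Longrightarrow> t \<le> b \<Longrightarrow> 0 \<le> \<epsilon> \<Longrightarrow>
       (\<And>s' u t'. s \<le> s' \<Longrightarrow> s' \<le> u \<Longrightarrow> u \<le> t' \<Longrightarrow> t' \<le> t \<Longrightarrow>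
          \<bar>\<Xi> s' t' - \<Xi> s' u - \<Xi> u t'\<bar> \<le> \<epsilon> * (V t' - V s') powr \<theta>) \<Longrightarrow>
       \<bar>F t - F s - \<Xi> s t\<bar> \<le> 2 / (1 - 2 powr (1 - \<theta>)) * \<epsilon> * (V t - V s) powr \<theta>"
proof -
  define C where "C = 2 / (1 - 2 powr (1 - \<theta>))"
  define valid where "valid s t \<epsilon> \<longleftrightarrow> a \<le> s \<and> s \<le> t \<and> t \<le> b \<and> 0 \<le> \<epsilon> \<and>
       (\<forall>s' u t'. s \<le> s' \<longrightarrow> s' \<le> u \<longrightarrow> u \<le> t' \<longrightarrow> t' \<le> t \<longrightarrow>
          \<bar>\<Xi> s' t' - \<Xi> s' u - \<Xi> u t'\<bar> \<le> \<epsilon> * (V t' - V s') powr \<theta>)" for s t \<epsilon>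
  define E where "E s t \<epsilon> = {F. \<bar>F t - F s - \<Xi> s t\<bar> \<le> C * \<epsilon> * (V t - V s) powr \<theta>}" for s t \<epsilon>
  \<comment> \<open>With the normalisation F a = 0, the constraint for \<open>(a, t, K)\<close>
    confines F t to [-B t, B t]. The product of these intervals is compact by Tychonoff, and every
    \<open>E s t \<epsilon>\<close> is closed in it, since it involves only two coordinates.\<close>
  define B where "B t = \<bar>\<Xi> a t\<bar> + \<bar>C * K * (V t - V a) powr \<theta>\<bar>" for t
  define U where "U = (\<Pi>\<^sub>E t\<in>UNIV. {- B t..B t})"
  have "compactin (product_topology (\<lambda>_. euclidean) UNIV) U"
    unfolding U_def by (subst compactin_PiE) auto
  then have "compact U" by (simp add: euclidean_product_topology)
  define \<A> where "\<A> = (\<lambda>(s, t, \<epsilon>). E s t \<epsilon>) ` {(s, t, \<epsilon>). valid s t \<epsilon>}"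
  have closed: "closed (E s t \<epsilon>)" for s t \<epsilon>
    unfolding E_def
    by (intro closed_Collect_le continuous_intros continuous_on_product_coordinates)
  have fin: "U \<inter> \<Inter>\<B> \<noteq> {}" if \<B>: "\<B> \<subseteq> \<A>" "finite \<B>" for \<B>
  proof -
    obtain J where J: "finite J" "J \<subseteq> {(s, t, \<epsilon>). valid s t \<epsilon>}" "\<B> = (\<lambda>(s, t, \<epsilon>). E s t \<epsilon>) ` J"
      using finite_subset_image[OF \<B>(2) \<B>(1)[unfolded \<A>_def]] by auto
    \<comment> \<open>All endpoints of the finitely many constraints; \<open>a\<close> is added as
      the point at which F is normalised.\<close>
    define A where "A = insert a ((\<lambda>(s, t, \<epsilon>). s) ` J \<union> (\<lambda>(s, t, \<epsilon>). t) ` J)"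
    have A: "finite A" "A \<subseteq> {a..b}"
      using J \<open>a \<le> b\<close> by (auto simp: A_def valid_def)
    define xs where "xs = sorted_list_of_set A"
    have xs: "set xs = A" "sorted xs" "distinct xs" using A by (auto simp: xs_def)
    define pos where "pos t = (SOME i. i < length xs \<and> xs ! i = t)" for t
    have pos: "pos t < length xs" "xs ! pos t = t" if "t \<in> A" for t
    proof -
      have "\<exists>i. i < length xs \<and> xs ! i = t" using that xs(1) by (metis in_set_conv_nth)
      from someI_ex[OF this] show "pos t < length xs" "xs ! pos t = t" by (simp_all add: pos_def)
    qed
    have pos_le: "pos s \<le> pos t" if "s \<in> A" "t \<in> A" "s \<le> t" for s t
    proof (rule ccontr)
      assume not_le: "\<not> pos s \<le> pos t"
      then have "t \<le> s" using sorted_nth_mono[OF xs(2), of "pos t" "pos s"] pos that by auto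
      with that have "s = t" by simp
      then show False using not_le by simp
    qed
    \<comment> \<open>Partial sums along the enumeration of \<open>A\<close>. The value 0 off
      \<open>A\<close> is harmless: the constraints in \<open>J\<close> look only at points of
      \<open>A\<close>, and 0 lies in every interval of the box.\<close>
    define F where "F t = (if t \<in> A then \<Sum>i=0..<pos t. \<Xi> (xs ! i) (xs ! Suc i) else 0)" for t
    have mem: "a \<le> xs ! i" "xs ! i \<le> b" if "i < length xs" for i
      using that A xs(1) nth_mem[OF that] by auto
    have key: "F \<in> E s t \<epsilon>" if v: "valid s t \<epsilon>" and st: "s \<in> A" "t \<in> A" for s t \<epsilon>
    proof -
      have "s \<le> t" using v by (auto simp: valid_def)
      then have le: "pos s \<le> pos t" using pos_le st by auto
      have "F t - F s = (\<Sum>i=pos s..<pos t. \<Xi> (xs ! i) (xs ! Suc i))"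
        using st le by (simp add: F_def sum.atLeastLessThan_concat[symmetric, of 0 "pos s" "pos t"])
      moreover have "\<bar>(\<Sum>i=pos s..<pos t. \<Xi> (xs ! i) (xs ! Suc i)) - \<Xi> (xs ! pos s) (xs ! pos t)\<bar>
          \<le> C * \<epsilon> * (V (xs ! pos t) - V (xs ! pos s)) powr \<theta>"
        unfolding C_def
      proof (rule discrete_sewing[where v = "\<lambda>i. V (xs ! i)" and \<xi> = "\<lambda>i j. \<Xi> (xs ! i) (xs ! j)"])
        show "V (xs ! i) \<le> V (xs ! j)" if "pos s \<le> i" "i \<le> j" "j \<le> pos t" for i j
          using that pos(1)[OF st(2)] mem[of i] mem[of j] sorted_nth_mono[OF xs(2), of i j]
          by (intro mono_onD[OF V]) auto
        show "\<Xi> (xs ! i) (xs ! i) = 0" if "pos s \<le> i" "i \<le> pos t" for i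
          using that pos(1)[OF st(2)] mem[of i] by (intro diag) auto
        show "\<bar>\<Xi> (xs ! i) (xs ! k) - \<Xi> (xs ! i) (xs ! j) - \<Xi> (xs ! j) (xs ! k)\<bar>
            \<le> \<epsilon> * (V (xs ! k) - V (xs ! i)) powr \<theta>"
          if "pos s \<le> i" "i \<le> j" "j \<le> k" "k \<le> pos t" for i j k
        proof -
          have "xs ! pos s \<le> xs ! i" "xs ! i \<le> xs ! j" "xs ! j \<le> xs ! k" "xs ! k \<le> xs ! pos t"
            using that pos(1)[OF st(2)] by (auto intro!: sorted_nth_mono[OF xs(2)])
          then show ?thesis using v pos(2)[OF st(1)] pos(2)[OF st(2)] by (auto simp: valid_def)
        qed
      qed (use assms(1) v le in \<open>auto simp: valid_def\<close>)
      ultimately show ?thesis using pos(2)[OF st(1)] pos(2)[OF st(2)] by (auto simp: E_def)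
    qed
    have aA: "a \<in> A" by (simp add: A_def)
    \<comment> \<open>As the least point of \<open>A\<close>, \<open>a\<close> comes first, so its
      partial sum is empty and F a = 0, as membership in the box requires.\<close>
    have "pos a = 0"
    proof (rule ccontr)
      assume "pos a \<noteq> 0"
      have len: "0 < length xs" using pos(1)[OF aA] by linarith
      then have "xs ! 0 = a"
        using mem[of 0] sorted_nth_mono[OF xs(2), of 0 "pos a"] pos[OF aA] by auto
      then show False using nth_eq_iff_index_eq[OF xs(3), of 0 "pos a"] pos[OF aA] len \<open>pos a \<noteq> 0\<close> by auto
    qed
    then have Fa: "F a = 0" by (simp add: F_def)
    have "F t \<in> {- B t..B t}" for t
    proof (cases "t \<in> A")
      case True
      then have "valid a t K" using A K \<open>0 \<le> K\<close> by (auto simp: valid_def)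
      from key[OF this aA True] show ?thesis using Fa by (auto simp: E_def B_def)
    qed (auto simp: F_def B_def)
    then have "F \<in> U" by (auto simp: U_def)
    moreover have "F \<in> \<Inter>\<B>"
    proof
      fix D assume "D \<in> \<B>"
      then obtain s t \<epsilon> where D: "(s, t, \<epsilon>) \<in> J" "D = E s t \<epsilon>" using J(3) by auto
      have "s \<in> A" "t \<in> A" unfolding A_def using D(1) by (auto intro: image_eqI[where x = "(s, t, \<epsilon>)"])
      then show "F \<in> D" using key D J(2) by auto
    qed
    ultimately show ?thesis by blast
  qed
  have "\<forall>D\<in>\<A>. closed D" using closed by (auto simp: \<A>_def)
  with fin \<open>compact U\<close>[unfolded compact_fip] have "U \<inter> \<Inter>\<A> \<noteq> {}" by blast
  then obtain F where F: "F \<in> \<Inter>\<A>" by auto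
  show ?thesis
  proof (rule that)
    fix s t \<epsilon> assume "a \<le> s" "s \<le> t" "t \<le> b" "0 \<le> \<epsilon>"
      "\<And>s' u t'. s \<le> s' \<Longrightarrow> s' \<le> u \<Longrightarrow> u \<le> t' \<Longrightarrow> t' \<le> t \<Longrightarrow>
          \<bar>\<Xi> s' t' - \<Xi> s' u - \<Xi> u t'\<bar> \<le> \<epsilon> * (V t' - V s') powr \<theta>"
    then have "valid s t \<epsilon>" by (auto simp: valid_def)
    then have "E s t \<epsilon> \<in> \<A>" by (auto simp: \<A>_def intro: image_eqI[where x = "(s, t, \<epsilon>)"])
    then have "F \<in> E s t \<epsilon>" using F by blast
    then show "\<bar>F t - F s - \<Xi> s t\<bar> \<le> 2 / (1 - 2 powr (1 - \<theta>)) * \<epsilon> * (V t - V s) powr \<theta>"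
      by (simp add: E_def C_def)
  qed
qed

section \<open>Young integration\<close>

text \<open>By Cousin's lemma, tagged divisions of arbitrarily small mesh exist, so the limit
  condition is not vacuous. This makes the description operator in \<open>RS_integral\<close>
  meaningful.\<close>

lemma has_RS_integral_unique:
  assumes "has_RS_integral f g a b I" "has_RS_integral f g a b J"
  shows "I = J"
proof (rule ccontr)
  assume "I \<noteq> J"
  then have e: "\<bar>I - J\<bar> / 2 > 0" by simp
  obtain d1 where d1: "d1 > 0" "\<And>D. D tagged_division_of {a..b} \<Longrightarrow> (\<forall>(x, K)\<in>D. Sup K - Inf K < d1) \<Longrightarrow>
        \<bar>(\<Sum>(x, K)\<in>D. f x * (g (Sup K) - g (Inf K))) - I\<bar> < \<bar>I - J\<bar> / 2"
    using assms(1) e unfolding has_RS_integral_def by meson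
  obtain d2 where d2: "d2 > 0" "\<And>D. D tagged_division_of {a..b} \<Longrightarrow> (\<forall>(x, K)\<in>D. Sup K - Inf K < d2) \<Longrightarrow>
        \<bar>(\<Sum>(x, K)\<in>D. f x * (g (Sup K) - g (Inf K))) - J\<bar> < \<bar>I - J\<bar> / 2"
    using assms(2) e unfolding has_RS_integral_def by meson
  \<comment> \<open>A cell inside a ball of radius \<open>d\<close> is shorter than 2d, hence
    shorter than both \<open>d1\<close> and \<open>d2\<close>.\<close>
  define d where "d = min d1 d2 / 3"
  have "d > 0" using d1 d2 by (simp add: d_def)
  then have "gauge (\<lambda>x. ball x d)" by auto
  then obtain D where D: "D tagged_division_of {a..b}" "(\<lambda>x. ball x d) fine D"
    by (rule fine_division_exists_real)
  have "Sup K - Inf K < min d1 d2" if xK: "(x, K) \<in> D" for x K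
  proof -
    obtain u v where K: "K = {u..v}" using tagged_division_ofD(4)[OF D(1) xK] by auto
    have "x \<in> K" using tagged_division_ofD(2)[OF D(1) xK] .
    moreover have "K \<subseteq> ball x d" using D(2) xK by (auto simp: fine_def)
    ultimately have "u \<le> v" and *: "{u..v} \<subseteq> ball x d" using K by auto
    moreover have "u \<in> ball x d" "v \<in> ball x d" using \<open>u \<le> v\<close> by (simp_all add: subsetD[OF *] del: mem_ball)
    ultimately have "v - u < 2 * d" by (simp add: dist_real_def)
    then show ?thesis using K \<open>u \<le> v\<close> d1(1) d2(1) by (auto simp: d_def min_def split: if_splits)
  qed
  then have mesh: "\<forall>(x, K)\<in>D. Sup K - Inf K < d1" "\<forall>(x, K)\<in>D. Sup K - Inf K < d2"
    by fastforce+
  have far: False if "\<bar>A - I\<bar> < \<bar>I - J\<bar> / 2" "\<bar>A - J\<bar> < \<bar>I - J\<bar> / 2" for A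
    using that by (simp add: abs_if split: if_splits)
  show False
    by (rule far[OF d1(2)[OF D(1) mesh(1)] d2(2)[OF D(1) mesh(2)]])
qed

text \<open>\<open>V\<close> stands for a normalised p-variation and \<open>\<alpha>\<close> for
  1/p. Values in [0,1] ensure that raising the exponent of an increment of \<open>V\<close> does not
  enlarge it. \<open>V\<close> may jump, so smallness over short intervals has to come from the
  continuity of an integrator.\<close>

locale control =
  fixes T \<alpha> :: real and V :: "real \<Rightarrow> real"
  assumes T_pos: "0 < T" and alpha: "1 / 2 < \<alpha>"
    and V_mono: "mono_on {0..T} V"
    and V_range: "V ` {0..T} \<subseteq> {0..1}"
begin

lemma dV:
  assumes "0 \<le> s" "s \<le> t" "t \<le> T"
  shows "0 \<le> V t - V s" "V t - V s \<le> 1"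
proof -
  have "V s \<in> {0..1}" "V t \<in> {0..1}" using V_range assms by (auto simp: image_subset_iff)
  moreover have "V s \<le> V t" using assms by (intro mono_onD[OF V_mono]) auto
  ultimately show "0 \<le> V t - V s" "V t - V s \<le> 1" by auto
qed

lemma dV_mono:
  assumes "0 \<le> s" "s \<le> p" "p \<le> q" "q \<le> t" "t \<le> T"
  shows "V q - V p \<le> V t - V s"
  using dV(1)[of s p] dV(1)[of q t] assms by simp

section \<open>Regularity relative to a control\<close>

definition holder :: "(real \<Rightarrow> real) \<Rightarrow> bool" where
  "holder f \<longleftrightarrow> (\<exists>c\<ge>0. \<forall>s t. 0 \<le> s \<longrightarrow> s \<le> t \<longrightarrow> t \<le> T \<longrightarrow> \<bar>f t - f s\<bar> \<le> c * (V t - V s) powr \<alpha>)"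

text \<open>Two arbitrary points of [s,t], in either order, are allowed, because sewing compares
  subintervals and Riemann sums compare tags with endpoints.\<close>

lemma holderE:
  assumes "holder f"
  obtains c where "c \<ge> 0"
    "\<And>s t p q. 0 \<le> s \<Longrightarrow> t \<le> T \<Longrightarrow> p \<in> {s..t} \<Longrightarrow> q \<in> {s..t} \<Longrightarrow> \<bar>f q - f p\<bar> \<le> c * (V t - V s) powr \<alpha>"
proof -
  obtain c where c: "c \<ge> 0"
    "\<And>s t. 0 \<le> s \<Longrightarrow> s \<le> t \<Longrightarrow> t \<le> T \<Longrightarrow> \<bar>f t - f s\<bar> \<le> c * (V t - V s) powr \<alpha>"
    using assms unfolding holder_def by blast
  have *: "\<bar>f q - f p\<bar> \<le> c * (V t - V s) powr \<alpha>" if "0 \<le> s" "t \<le> T" "s \<le> p" "p \<le> q" "q \<le> t" for s t p q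
  proof -
    have "c * (V q - V p) powr \<alpha> \<le> c * (V t - V s) powr \<alpha>"
      using that dV[of p q] dV_mono[of s p q t] c(1) alpha by (intro mult_left_mono powr_mono2) auto
    with c(2)[of p q] that show ?thesis by linarith
  qed
  show ?thesis
  proof (rule that[OF c(1)])
    fix s t p q assume "0 \<le> s" "t \<le> T" "p \<in> {s..t}" "q \<in> {s..t}"
    then show "\<bar>f q - f p\<bar> \<le> c * (V t - V s) powr \<alpha>"
      using *[of s t p q] *[of s t q p] by (cases "p \<le> q") (auto simp: abs_minus_commute)
  qed
qed

lemma holder_bounded:
  assumes "holder f"
  obtains B where "B \<ge> 0" "\<And>t. t \<in> {0..T} \<Longrightarrow> \<bar>f t\<bar> \<le> B"
proof -
  obtain c where c: "c \<ge> 0"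
    "\<And>s t p q. 0 \<le> s \<Longrightarrow> t \<le> T \<Longrightarrow> p \<in> {s..t} \<Longrightarrow> q \<in> {s..t} \<Longrightarrow> \<bar>f q - f p\<bar> \<le> c * (V t - V s) powr \<alpha>"
    by (rule holderE[OF assms]) (rule that; blast)
  have "\<bar>f t\<bar> \<le> \<bar>f 0\<bar> + c * (V T - V 0) powr \<alpha>" if "t \<in> {0..T}" for t
    using c(2)[of 0 T 0 t] that by auto
  then show ?thesis using c(1) by (intro that[of "\<bar>f 0\<bar> + c * (V T - V 0) powr \<alpha>"]) auto
qed

lemma holder_cong:
  assumes "holder f" "\<And>t. t \<in> {0..T} \<Longrightarrow> f t = g t + c"
  shows "holder g"
proof -
  have "g t - g s = f t - f s" if "0 \<le> s" "s \<le> t" "t \<le> T" for s t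
    using assms(2)[of s] assms(2)[of t] that by auto
  then show ?thesis using assms(1) unfolding holder_def by metis
qed

text \<open>The exponent \<open>\<alpha> + 1/2\<close> lies strictly between \<open>1\<close> and \<open>2\<alpha>\<close>, which leaves a
  positive power of \<open>\<bar>g w - g r\<bar>\<close> to be made small by uniform continuity.\<close>

lemma holder_product_fine:
  assumes "holder f" "holder g" "continuous_on {0..T} g" "\<epsilon> > 0"
  obtains \<delta> where "\<delta> > 0"
    "\<And>s t p q r w. 0 \<le> s \<Longrightarrow> t \<le> T \<Longrightarrow> t - s < \<delta> \<Longrightarrow>
       p \<in> {s..t} \<Longrightarrow> q \<in> {s..t} \<Longrightarrow> r \<in> {s..t} \<Longrightarrow> w \<in> {s..t} \<Longrightarrow>
       \<bar>f q - f p\<bar> * \<bar>g w - g r\<bar> \<le> \<epsilon> * (V t - V s) powr (\<alpha> + 1 / 2)"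
proof -
  obtain c where c: "c \<ge> 0"
    "\<And>s t p q. 0 \<le> s \<Longrightarrow> t \<le> T \<Longrightarrow> p \<in> {s..t} \<Longrightarrow> q \<in> {s..t} \<Longrightarrow> \<bar>f q - f p\<bar> \<le> c * (V t - V s) powr \<alpha>"
    by (rule holderE[OF assms(1)]) (rule that; blast)
  obtain d where d: "d \<ge> 0"
    "\<And>s t p q. 0 \<le> s \<Longrightarrow> t \<le> T \<Longrightarrow> p \<in> {s..t} \<Longrightarrow> q \<in> {s..t} \<Longrightarrow> \<bar>g q - g p\<bar> \<le> d * (V t - V s) powr \<alpha>"
    by (rule holderE[OF assms(2)]) (rule that; blast)
  \<comment> \<open>Of the increment y of \<open>g\<close>, the power 1/(2\<alpha>) already yields
    the factor \<omega>^(1/2); \<open>\<kappa>\<close> is the exponent left over, positive because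
    \<alpha> > 1/2.\<close>
  define \<kappa> where "\<kappa> = 1 - 1 / (2 * \<alpha>)"
  have \<kappa>: "\<kappa> > 0" using alpha by (simp add: \<kappa>_def field_simps)
  define M where "M = c * d powr (1 / (2 * \<alpha>))"
  have M: "M \<ge> 0" using c d by (simp add: M_def)
  \<comment> \<open>Chosen so that M \<eta>^\<kappa> \<le> \<epsilon>; the summand 1 covers M =
    0.\<close>
  define \<eta> where "\<eta> = (\<epsilon> / (M + 1)) powr (1 / \<kappa>)"
  have \<eta>: "\<eta> > 0" "\<eta> powr \<kappa> = \<epsilon> / (M + 1)"
    using \<open>\<epsilon> > 0\<close> M \<kappa> by (auto simp: \<eta>_def powr_powr)
  have "uniformly_continuous_on {0..T} g"
    using assms(3) by (intro compact_uniformly_continuous) auto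
  then obtain \<delta> where \<delta>: "\<delta> > 0"
    "\<And>x y. x \<in> {0..T} \<Longrightarrow> y \<in> {0..T} \<Longrightarrow> dist y x < \<delta> \<Longrightarrow> dist (g y) (g x) < \<eta>"
    using \<eta>(1) unfolding uniformly_continuous_on_def by metis
  show ?thesis
  proof (rule that[OF \<delta>(1)])
    fix s t p q r w
    assume *: "0 \<le> s" "t \<le> T" "t - s < \<delta>" "p \<in> {s..t}" "q \<in> {s..t}" "r \<in> {s..t}" "w \<in> {s..t}"
    define \<omega> where "\<omega> = V t - V s"
    have \<omega>: "\<omega> \<ge> 0" using dV[of s t] * by (simp add: \<omega>_def)
    define y where "y = \<bar>g w - g r\<bar>"
    have wr: "\<bar>w - r\<bar> < \<delta>" using * by (simp add: abs_if)
    have y: "0 \<le> y" "y \<le> d * \<omega> powr \<alpha>" "y \<le> \<eta>"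
      using d(2)[of s t r w] \<delta>(2)[of r w] * wr by (auto simp: y_def \<omega>_def dist_real_def)
    have "y = y powr (1 / (2 * \<alpha>)) * y powr \<kappa>"
      using y(1) by (cases "y = 0") (auto simp: \<kappa>_def simp flip: powr_add)
    also have "\<dots> \<le> (d * \<omega> powr \<alpha>) powr (1 / (2 * \<alpha>)) * \<eta> powr \<kappa>"
      using y \<kappa> alpha by (intro mult_mono powr_mono2) auto
    also have "(d * \<omega> powr \<alpha>) powr (1 / (2 * \<alpha>)) = d powr (1 / (2 * \<alpha>)) * \<omega> powr (1 / 2)"
      using d(1) alpha by (simp add: powr_mult powr_powr)
    finally have y2: "y \<le> d powr (1 / (2 * \<alpha>)) * \<omega> powr (1 / 2) * \<eta> powr \<kappa>" .
    have "\<bar>f q - f p\<bar> * y \<le> (c * \<omega> powr \<alpha>) * (d powr (1 / (2 * \<alpha>)) * \<omega> powr (1 / 2) * \<eta> powr \<kappa>)"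
      using c(2)[of s t p q] * y2 y(1) c(1) by (intro mult_mono) (auto simp: \<omega>_def)
    also have "\<dots> = M * (\<epsilon> / (M + 1)) * \<omega> powr (\<alpha> + 1 / 2)"
      by (simp add: M_def \<eta>(2) powr_add)
    also have "\<dots> \<le> \<epsilon> * \<omega> powr (\<alpha> + 1 / 2)"
      using M \<open>\<epsilon> > 0\<close> by (intro mult_right_mono) (auto simp: field_simps)
    finally show "\<bar>f q - f p\<bar> * \<bar>g w - g r\<bar> \<le> \<epsilon> * (V t - V s) powr (\<alpha> + 1 / 2)"
      by (simp add: y_def \<omega>_def)
  qed
qed

text \<open>\<open>F\<close> is an indefinite integral of \<open>f dg\<close> iff \<open>F t - F s - f s (g t - g s)\<close> is
  negligible, so that identities between iterated integrals become algebra modulo negligible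
  functions.\<close>

definition negligible :: "(real \<Rightarrow> real \<Rightarrow> real) \<Rightarrow> bool" where
  "negligible R \<longleftrightarrow> (\<forall>\<epsilon>>0. \<exists>\<delta>>0. \<forall>s t. 0 \<le> s \<longrightarrow> s \<le> t \<longrightarrow> t \<le> T \<longrightarrow> t - s < \<delta> \<longrightarrow>
     \<bar>R s t\<bar> \<le> \<epsilon> * (V t - V s))"

section \<open>Calculus modulo negligible functions\<close>

lemma negligibleE:
  assumes "negligible R" "\<epsilon> > 0"
  obtains \<delta> where "\<delta> > 0"
    "\<And>s t. 0 \<le> s \<Longrightarrow> s \<le> t \<Longrightarrow> t \<le> T \<Longrightarrow> t - s < \<delta> \<Longrightarrow> \<bar>R s t\<bar> \<le> \<epsilon> * (V t - V s)"
  using assms unfolding negligible_def by meson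

lemma negligible_cong:
  assumes "negligible R" "\<And>s t. 0 \<le> s \<Longrightarrow> s \<le> t \<Longrightarrow> t \<le> T \<Longrightarrow> R' s t = R s t"
  shows "negligible R'"
  using assms unfolding negligible_def by simp

lemma negligible_0: "negligible (\<lambda>s t. 0)"
  unfolding negligible_def using dV by (intro allI impI exI[of _ 1]) auto

lemma negligible_add:
  assumes "negligible R" "negligible S"
  shows "negligible (\<lambda>s t. R s t + S s t)"
  unfolding negligible_def
proof (intro allI impI)
  fix \<epsilon> :: real assume "\<epsilon> > 0"
  then have e: "\<epsilon> / 2 > 0" by simp
  obtain d1 where d1: "d1 > 0"
    "\<And>s t. 0 \<le> s \<Longrightarrow> s \<le> t \<Longrightarrow> t \<le> T \<Longrightarrow> t - s < d1 \<Longrightarrow> \<bar>R s t\<bar> \<le> \<epsilon> / 2 * (V t - V s)"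
    by (rule negligibleE[OF assms(1) e]) (rule that; blast)
  obtain d2 where d2: "d2 > 0"
    "\<And>s t. 0 \<le> s \<Longrightarrow> s \<le> t \<Longrightarrow> t \<le> T \<Longrightarrow> t - s < d2 \<Longrightarrow> \<bar>S s t\<bar> \<le> \<epsilon> / 2 * (V t - V s)"
    by (rule negligibleE[OF assms(2) e]) (rule that; blast)
  show "\<exists>\<delta>>0. \<forall>s t. 0 \<le> s \<longrightarrow> s \<le> t \<longrightarrow> t \<le> T \<longrightarrow> t - s < \<delta> \<longrightarrow> \<bar>R s t + S s t\<bar> \<le> \<epsilon> * (V t - V s)"
  proof (intro exI[of _ "min d1 d2"] conjI allI impI)
    fix s t assume "0 \<le> s" "s \<le> t" "t \<le> T" "t - s < min d1 d2"
    then show "\<bar>R s t + S s t\<bar> \<le> \<epsilon> * (V t - V s)"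
      using d1(2)[of s t] d2(2)[of s t] by (simp add: field_simps)
  qed (use d1 d2 in auto)
qed

lemma negligible_mult_bounded:
  assumes "negligible R" and f: "\<And>t. t \<in> {0..T} \<Longrightarrow> \<bar>f t\<bar> \<le> B"
  shows "negligible (\<lambda>s t. f s * R s t)"
  unfolding negligible_def
proof (intro allI impI)
  fix \<epsilon> :: real assume "\<epsilon> > 0"
  have B: "B \<ge> 0" using f[of 0] T_pos by auto
  then have e: "\<epsilon> / (B + 1) > 0" using \<open>\<epsilon> > 0\<close> by simp
  obtain d where d: "d > 0"
    "\<And>s t. 0 \<le> s \<Longrightarrow> s \<le> t \<Longrightarrow> t \<le> T \<Longrightarrow> t - s < d \<Longrightarrow> \<bar>R s t\<bar> \<le> \<epsilon> / (B + 1) * (V t - V s)"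
    by (rule negligibleE[OF assms(1) e]) (rule that; blast)
  show "\<exists>\<delta>>0. \<forall>s t. 0 \<le> s \<longrightarrow> s \<le> t \<longrightarrow> t \<le> T \<longrightarrow> t - s < \<delta> \<longrightarrow> \<bar>f s * R s t\<bar> \<le> \<epsilon> * (V t - V s)"
  proof (intro exI[of _ d] conjI allI impI)
    fix s t assume st: "0 \<le> s" "s \<le> t" "t \<le> T" "t - s < d"
    have "\<bar>f s\<bar> * \<bar>R s t\<bar> \<le> B * (\<epsilon> / (B + 1) * (V t - V s))"
      using f[of s] d(2)[of s t] st B by (intro mult_mono) auto
    also have "\<dots> = B * \<epsilon> / (B + 1) * (V t - V s)" by simp
    also have "\<dots> \<le> \<epsilon> * (V t - V s)"
      using B \<open>\<epsilon> > 0\<close> dV[of s t] st by (intro mult_right_mono) (auto simp: field_simps)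
    finally show "\<bar>f s * R s t\<bar> \<le> \<epsilon> * (V t - V s)" by (simp add: abs_mult)
  qed (use d in auto)
qed

lemma negligible_uminus: "negligible R \<Longrightarrow> negligible (\<lambda>s t. - R s t)"
  unfolding negligible_def by simp

lemma negligible_diff:
  assumes "negligible R" "negligible S"
  shows "negligible (\<lambda>s t. R s t - S s t)"
  using negligible_add[OF assms(1) negligible_uminus[OF assms(2)]] by simp

lemma negligible_sum_list:
  assumes "\<And>u. u \<in> set us \<Longrightarrow> negligible (R u)"
  shows "negligible (\<lambda>s t. \<Sum>u\<leftarrow>us. R u s t)"
  using assms by (induction us) (auto intro: negligible_0 negligible_add)

text \<open>The base lies in [0,1] and the exponent exceeds 1. This turns sewing bounds into bounds
  by increments of \<open>V\<close>, which telescope.\<close>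

lemma powr_dV_le:
  assumes "0 \<le> s" "s \<le> t" "t \<le> T"
  shows "(V t - V s) powr (\<alpha> + 1 / 2) \<le> V t - V s"
  using powr_mono'[of 1 "\<alpha> + 1 / 2" "V t - V s"] dV[OF assms] alpha by simp

text \<open>The quadratic covariation vanishes, so the product rule for these integrals has no
  correction term.\<close>

lemma negligible_product:
  assumes "holder f" "holder g" "continuous_on {0..T} g"
  shows "negligible (\<lambda>s t. (f t - f s) * (g t - g s))"
  unfolding negligible_def
proof (intro allI impI)
  fix \<epsilon> :: real assume "\<epsilon> > 0"
  obtain \<delta> where \<delta>: "\<delta> > 0" "\<And>s t p q r w. 0 \<le> s \<Longrightarrow> t \<le> T \<Longrightarrow> t - s < \<delta> \<Longrightarrow>
       p \<in> {s..t} \<Longrightarrow> q \<in> {s..t} \<Longrightarrow> r \<in> {s..t} \<Longrightarrow> w \<in> {s..t} \<Longrightarrow>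
       \<bar>f q - f p\<bar> * \<bar>g w - g r\<bar> \<le> \<epsilon> * (V t - V s) powr (\<alpha> + 1 / 2)"
    by (rule holder_product_fine[OF assms \<open>\<epsilon> > 0\<close>]) (rule that; blast)
  show "\<exists>\<delta>>0. \<forall>s t. 0 \<le> s \<longrightarrow> s \<le> t \<longrightarrow> t \<le> T \<longrightarrow> t - s < \<delta> \<longrightarrow>
          \<bar>(f t - f s) * (g t - g s)\<bar> \<le> \<epsilon> * (V t - V s)"
  proof (intro exI[of _ \<delta>] conjI allI impI)
    fix s t assume st: "0 \<le> s" "s \<le> t" "t \<le> T" "t - s < \<delta>"
    have "\<bar>(f t - f s) * (g t - g s)\<bar> \<le> \<epsilon> * (V t - V s) powr (\<alpha> + 1 / 2)"
      using \<delta>(2)[of s t s t s t] st by (simp add: abs_mult)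
    also have "\<dots> \<le> \<epsilon> * (V t - V s)"
      using powr_dV_le[of s t] st \<open>\<epsilon> > 0\<close> by (intro mult_left_mono) auto
    finally show "\<bar>(f t - f s) * (g t - g s)\<bar> \<le> \<epsilon> * (V t - V s)" .
  qed (use \<delta> in auto)
qed

text \<open>Sewing is applied to f s (g t - g s), whose failure to be additive is a product of two
  increments. The global constant c d gives regularity of F, and arbitrarily small local constants
  on short intervals give negligibility.\<close>

lemma young_integral_exists:
  assumes f: "holder f" and g: "holder g" "continuous_on {0..T} g"
  obtains F where "holder F" "negligible (\<lambda>s t. F t - F s - f s * (g t - g s))"
proof -
  define \<Xi> where "\<Xi> s t = f s * (g t - g s)" for s t
  define C where "C = 2 / (1 - 2 powr (1 - (\<alpha> + 1 / 2)))"
  have "2 powr (1 - (\<alpha> + 1 / 2)) < (2::real) powr 0"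
    using alpha by (subst powr_less_cancel_iff) auto
  then have C: "C > 0" by (simp add: C_def)
  have \<delta>\<Xi>: "\<bar>\<Xi> s t - \<Xi> s u - \<Xi> u t\<bar> = \<bar>f u - f s\<bar> * \<bar>g t - g u\<bar>" for s u t
    unfolding abs_mult[symmetric] \<Xi>_def by (subst abs_minus_cancel[symmetric]) (simp add: algebra_simps)
  obtain c where c: "c \<ge> 0"
    "\<And>s t p q. 0 \<le> s \<Longrightarrow> t \<le> T \<Longrightarrow> p \<in> {s..t} \<Longrightarrow> q \<in> {s..t} \<Longrightarrow> \<bar>f q - f p\<bar> \<le> c * (V t - V s) powr \<alpha>"
    by (rule holderE[OF f]) (rule that; blast)
  obtain d where d: "d \<ge> 0"
    "\<And>s t p q. 0 \<le> s \<Longrightarrow> t \<le> T \<Longrightarrow> p \<in> {s..t} \<Longrightarrow> q \<in> {s..t} \<Longrightarrow> \<bar>g q - g p\<bar> \<le> d * (V t - V s) powr \<alpha>"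
    by (rule holderE[OF g(1)]) (rule that; blast)
  \<comment> \<open>The natural exponent 2\<alpha> is lowered to \<alpha> + 1/2, so that the global
    and the local bounds have the same exponent, as \<open>sewing\<close> demands.\<close>
  have K: "\<bar>\<Xi> s t - \<Xi> s u - \<Xi> u t\<bar> \<le> c * d * (V t - V s) powr (\<alpha> + 1 / 2)"
    if "0 \<le> s" "s \<le> u" "u \<le> t" "t \<le> T" for s u t
  proof -
    have "\<bar>f u - f s\<bar> * \<bar>g t - g u\<bar> \<le> (c * (V t - V s) powr \<alpha>) * (d * (V t - V s) powr \<alpha>)"
      using c(2)[of s t s u] d(2)[of s t u t] c(1) that by (intro mult_mono) auto
    also have "\<dots> = c * d * (V t - V s) powr (\<alpha> + \<alpha>)" by (simp only: powr_add mult_ac)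
    also have "\<dots> \<le> c * d * (V t - V s) powr (\<alpha> + 1 / 2)"
      using dV[of s t] that alpha c d by (intro mult_left_mono powr_mono') auto
    finally show ?thesis by (simp add: \<delta>\<Xi>)
  qed
  obtain F where F: "\<And>s t \<epsilon>. 0 \<le> s \<Longrightarrow> s \<le> t \<Longrightarrow> t \<le> T \<Longrightarrow> 0 \<le> \<epsilon> \<Longrightarrow>
       (\<And>s' u t'. s \<le> s' \<Longrightarrow> s' \<le> u \<Longrightarrow> u \<le> t' \<Longrightarrow> t' \<le> t \<Longrightarrow>
          \<bar>\<Xi> s' t' - \<Xi> s' u - \<Xi> u t'\<bar> \<le> \<epsilon> * (V t' - V s') powr (\<alpha> + 1 / 2)) \<Longrightarrow>
       \<bar>F t - F s - \<Xi> s t\<bar> \<le> C * \<epsilon> * (V t - V s) powr (\<alpha> + 1 / 2)"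
    unfolding C_def using alpha c d T_pos V_mono K
    by (rule_tac sewing[where a = 0 and b = T and V = V and \<Xi> = \<Xi> and \<theta> = "\<alpha> + 1 / 2" and K = "c * d"])
       (auto simp: \<Xi>_def)
  obtain B where B: "B \<ge> 0" "\<And>t. t \<in> {0..T} \<Longrightarrow> \<bar>f t\<bar> \<le> B"
    by (rule holder_bounded[OF f]) (rule that; blast)
  have "holder F"
    unfolding holder_def
  proof (intro exI[of _ "C * (c * d) + B * d"] conjI allI impI)
    fix s t assume st: "0 \<le> s" "s \<le> t" "t \<le> T"
    have "\<bar>F t - F s - \<Xi> s t\<bar> \<le> C * (c * d) * (V t - V s) powr (\<alpha> + 1 / 2)"
      using st c d K by (intro F) auto
    also have "\<dots> \<le> C * (c * d) * (V t - V s) powr \<alpha>"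
      using dV[of s t] st c d C by (intro mult_left_mono powr_mono') auto
    finally have 1: "\<bar>F t - F s - \<Xi> s t\<bar> \<le> C * (c * d) * (V t - V s) powr \<alpha>" .
    have "\<bar>\<Xi> s t\<bar> \<le> B * (d * (V t - V s) powr \<alpha>)"
      unfolding \<Xi>_def abs_mult using B d(2)[of s t s t] st by (intro mult_mono) auto
    with 1 show "\<bar>F t - F s\<bar> \<le> (C * (c * d) + B * d) * (V t - V s) powr \<alpha>"
      by (simp add: algebra_simps)
  qed (use C c d B in auto)
  moreover have "negligible (\<lambda>s t. F t - F s - f s * (g t - g s))"
    unfolding negligible_def
  proof (intro allI impI)
    fix \<epsilon> :: real assume "\<epsilon> > 0"
    then have e: "\<epsilon> / C > 0" using C by simp
    obtain \<delta> where \<delta>: "\<delta> > 0" "\<And>s t p q r w. 0 \<le> s \<Longrightarrow> t \<le> T \<Longrightarrow> t - s < \<delta> \<Longrightarrow>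
         p \<in> {s..t} \<Longrightarrow> q \<in> {s..t} \<Longrightarrow> r \<in> {s..t} \<Longrightarrow> w \<in> {s..t} \<Longrightarrow>
         \<bar>f q - f p\<bar> * \<bar>g w - g r\<bar> \<le> \<epsilon> / C * (V t - V s) powr (\<alpha> + 1 / 2)"
      by (rule holder_product_fine[OF f g e]) (rule that; blast)
    show "\<exists>\<delta>>0. \<forall>s t. 0 \<le> s \<longrightarrow> s \<le> t \<longrightarrow> t \<le> T \<longrightarrow> t - s < \<delta> \<longrightarrow>
            \<bar>F t - F s - f s * (g t - g s)\<bar> \<le> \<epsilon> * (V t - V s)"
    proof (intro exI[of _ \<delta>] conjI allI impI)
      fix s t assume st: "0 \<le> s" "s \<le> t" "t \<le> T" "t - s < \<delta>"
      have "\<bar>\<Xi> s' t' - \<Xi> s' u - \<Xi> u t'\<bar> \<le> \<epsilon> / C * (V t' - V s') powr (\<alpha> + 1 / 2)"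
        if "s \<le> s'" "s' \<le> u" "u \<le> t'" "t' \<le> t" for s' u t'
        unfolding \<delta>\<Xi> using that st by (intro \<delta>(2)) auto
      then have "\<bar>F t - F s - \<Xi> s t\<bar> \<le> C * (\<epsilon> / C) * (V t - V s) powr (\<alpha> + 1 / 2)"
        using st e by (intro F) auto
      also have "\<dots> \<le> \<epsilon> * (V t - V s)"
        using powr_dV_le[of s t] st \<open>\<epsilon> > 0\<close> C by simp
      finally show "\<bar>F t - F s - f s * (g t - g s)\<bar> \<le> \<epsilon> * (V t - V s)" by (simp add: \<Xi>_def)
    qed (use \<delta> in auto)
  qed
  ultimately show ?thesis by (rule that)
qed

text \<open>F b - F 0 telescopes over the cells. Moving the tag to the left endpoint and replacing
  the germ by the increment of F each cost at most \<epsilon>/4 times the increment of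
  \<open>V\<close>; these errors sum to at most \<epsilon>/2 since \<open>V\<close> varies by at
  most 1.\<close>

lemma has_RS_integral_young:
  assumes f: "holder f" and g: "holder g" "continuous_on {0..T} g"
    and F: "negligible (\<lambda>s t. F t - F s - f s * (g t - g s))"
    and b: "0 \<le> b" "b \<le> T"
  shows "has_RS_integral f g 0 b (F b - F 0)"
  unfolding has_RS_integral_def
proof (intro allI impI)
  fix \<epsilon> :: real assume "\<epsilon> > 0"
  then have e: "\<epsilon> / 4 > 0" by simp
  obtain d1 where d1: "d1 > 0" "\<And>s t p q r w. 0 \<le> s \<Longrightarrow> t \<le> T \<Longrightarrow> t - s < d1 \<Longrightarrow>
       p \<in> {s..t} \<Longrightarrow> q \<in> {s..t} \<Longrightarrow> r \<in> {s..t} \<Longrightarrow> w \<in> {s..t} \<Longrightarrow>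
       \<bar>f q - f p\<bar> * \<bar>g w - g r\<bar> \<le> \<epsilon> / 4 * (V t - V s) powr (\<alpha> + 1 / 2)"
    by (rule holder_product_fine[OF f g e]) (rule that; blast)
  obtain d2 where d2: "d2 > 0" "\<And>s t. 0 \<le> s \<Longrightarrow> s \<le> t \<Longrightarrow> t \<le> T \<Longrightarrow> t - s < d2 \<Longrightarrow>
       \<bar>F t - F s - f s * (g t - g s)\<bar> \<le> \<epsilon> / 4 * (V t - V s)"
    by (rule negligibleE[OF F e]) (rule that; blast)
  show "\<exists>\<delta>>0. \<forall>D. D tagged_division_of {0..b} \<and> (\<forall>(x, K)\<in>D. Sup K - Inf K < \<delta>) \<longrightarrow>
          \<bar>(\<Sum>(x, K)\<in>D. f x * (g (Sup K) - g (Inf K))) - (F b - F 0)\<bar> < \<epsilon>"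
  proof (intro exI[of _ "min d1 d2"] conjI allI impI)
    fix D assume "D tagged_division_of {0..b} \<and> (\<forall>(x, K)\<in>D. Sup K - Inf K < min d1 d2)"
    then have D: "D tagged_division_of {0..b}" "\<And>x K. (x, K) \<in> D \<Longrightarrow> Sup K - Inf K < min d1 d2" by auto
    have cell: "\<bar>f x * (g (Sup K) - g (Inf K)) - (F (Sup K) - F (Inf K))\<bar> \<le> \<epsilon> / 2 * (V (Sup K) - V (Inf K))"
      if xK: "(x, K) \<in> D" for x K
    proof -
      obtain s t where K: "K = {s..t}" using tagged_division_ofD(4)[OF D(1) xK] by auto
      have x: "x \<in> {s..t}" using tagged_division_ofD(2)[OF D(1) xK] K by simp
      then have "s \<le> t" by simp
      have "{s..t} \<subseteq> {0..b}" using tagged_division_ofD(3)[OF D(1) xK] K by simp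
      then have st: "0 \<le> s" "t \<le> T" using \<open>s \<le> t\<close> b by auto
      have m: "t - s < d1" "t - s < d2" using D(2)[OF xK] K \<open>s \<le> t\<close> by auto
      have "\<bar>(f x - f s) * (g t - g s)\<bar> \<le> \<epsilon> / 4 * (V t - V s) powr (\<alpha> + 1 / 2)"
        unfolding abs_mult using st m x \<open>s \<le> t\<close> by (intro d1(2)) auto
      also have "\<dots> \<le> \<epsilon> / 4 * (V t - V s)"
        using powr_dV_le[of s t] st \<open>s \<le> t\<close> e by (intro mult_left_mono) auto
      finally have 1: "\<bar>(f x - f s) * (g t - g s)\<bar> \<le> \<epsilon> / 4 * (V t - V s)" .
      have "f x * (g t - g s) - (F t - F s) = (f x - f s) * (g t - g s) - (F t - F s - f s * (g t - g s))"
        by (simp add: algebra_simps)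
      then have "\<bar>f x * (g t - g s) - (F t - F s)\<bar>
          \<le> \<bar>(f x - f s) * (g t - g s)\<bar> + \<bar>F t - F s - f s * (g t - g s)\<bar>"
        by (simp only: abs_triangle_ineq4)
      also have "\<dots> \<le> \<epsilon> / 4 * (V t - V s) + \<epsilon> / 4 * (V t - V s)"
        using st \<open>s \<le> t\<close> m by (intro add_mono 1 d2(2))
      also have "\<dots> = \<epsilon> / 2 * (V t - V s)" by (simp add: field_simps)
      finally have "\<bar>f x * (g t - g s) - (F t - F s)\<bar> \<le> \<epsilon> / 2 * (V t - V s)" .
      then show ?thesis using K \<open>s \<le> t\<close> by simp
    qed
    have "(\<Sum>(x, K)\<in>D. f x * (g (Sup K) - g (Inf K))) - (F b - F 0)
        = (\<Sum>(x, K)\<in>D. f x * (g (Sup K) - g (Inf K)) - (F (Sup K) - F (Inf K)))"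
      using additive_tagged_division_1[OF b(1) D(1), of F] by (simp add: sum_subtractf case_prod_beta)
    also have "\<bar>\<dots>\<bar> \<le> (\<Sum>(x, K)\<in>D. \<epsilon> / 2 * (V (Sup K) - V (Inf K)))"
      using cell by (intro order_trans[OF sum_abs] sum_mono) auto
    also have "\<dots> = \<epsilon> / 2 * (\<Sum>(x, K)\<in>D. V (Sup K) - V (Inf K))"
      unfolding sum_distrib_left by (rule sum.cong) auto
    also have "\<dots> = \<epsilon> / 2 * (V b - V 0)"
      by (simp only: additive_tagged_division_1[OF b(1) D(1)])
    also have "\<dots> \<le> \<epsilon> / 2 * 1"
      using dV[of 0 b] b \<open>\<epsilon> > 0\<close> by (intro mult_left_mono) auto
    also have "\<dots> < \<epsilon>" using \<open>\<epsilon> > 0\<close> by simp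
    finally show "\<bar>(\<Sum>(x, K)\<in>D. f x * (g (Sup K) - g (Inf K))) - (F b - F 0)\<bar> < \<epsilon>" .
  qed (use d1 d2 in auto)
qed

lemma RS_integral_young:
  assumes "holder f" "holder g" "continuous_on {0..T} g"
    and "negligible (\<lambda>s t. F t - F s - f s * (g t - g s))"
    and "0 \<le> b" "b \<le> T"
  shows "RS_integral f g 0 b = F b - F 0"
  unfolding RS_integral_def
  by (rule the_equality) (use has_RS_integral_young[OF assms] has_RS_integral_unique in auto)

lemma holder_const: "holder (\<lambda>_. c)"
  unfolding holder_def by (intro exI[of _ 0]) auto

text \<open>Both F and the constant 0 are indefinite integrals of 0 against 0, so uniqueness of the
  integral forces their increments to agree.\<close>

lemma negligible_increment_imp_const:
  assumes "negligible (\<lambda>s t. F t - F s)" "0 \<le> b" "b \<le> T"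
  shows "F b = F 0"
proof -
  have "RS_integral (\<lambda>_. 0) (\<lambda>_. 0) 0 b = F b - F 0"
    using assms by (intro RS_integral_young holder_const) auto
  moreover have "RS_integral (\<lambda>_. 0) (\<lambda>_. 0) 0 b = (0::real) - 0"
    using assms by (intro RS_integral_young[where F = "\<lambda>_. 0"] holder_const) (auto intro: negligible_0)
  ultimately show ?thesis by simp
qed


end

section \<open>Iterated integrals\<close>

text \<open>The words of the shuffle product of the letter \<open>i\<close> with the word \<open>w\<close>.\<close>

primrec insertions :: "'a \<Rightarrow> 'a list \<Rightarrow> 'a list list" where
  "insertions i [] = [[i]]"
| "insertions i (j # w) = (i # j # w) # map ((#) j) (insertions i w)"

locale controlled_path = control T \<alpha> V
  for T \<alpha> :: real and V :: "real \<Rightarrow> real" +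
  fixes X :: "real \<Rightarrow> real ^ 'd::finite"
  assumes holder_X: "holder (\<lambda>s. X s $ i)"
    and continuous_X: "continuous_on {0..T} (\<lambda>s. X s $ i)"
begin

text \<open>Both claims come from one induction step: regularity of the integral for
  \<open>w\<close> is what allows integrating it once more.\<close>

lemma holder_iterated_integral: "holder (iterated_integral X w)"
  and negligible_iterated_integral:
    "negligible (\<lambda>s t. iterated_integral X (i # w) t - iterated_integral X (i # w) s
       - iterated_integral X w s * (X t $ i - X s $ i))"
proof -
  have Cons: "holder (iterated_integral X (i # w)) \<and>
      negligible (\<lambda>s t. iterated_integral X (i # w) t - iterated_integral X (i # w) s
       - iterated_integral X w s * (X t $ i - X s $ i))"
    if w: "holder (iterated_integral X w)" for w i
  proof -
    obtain F where F: "holder F"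
      "negligible (\<lambda>s t. F t - F s - iterated_integral X w s * (X t $ i - X s $ i))"
      using young_integral_exists[OF w holder_X[of i] continuous_X[of i]] .
    have eq: "iterated_integral X (i # w) t = F t - F 0" if "0 \<le> t" "t \<le> T" for t
      using RS_integral_young[OF w holder_X continuous_X F(2) that] by simp
    have "holder (iterated_integral X (i # w))"
      using eq by (intro holder_cong[OF F(1), of _ "F 0"]) (simp del: iterated_integral.simps)
    moreover have "negligible (\<lambda>s t. iterated_integral X (i # w) t - iterated_integral X (i # w) s
       - iterated_integral X w s * (X t $ i - X s $ i))"
      using eq by (intro negligible_cong[OF F(2)]) (simp del: iterated_integral.simps)
    ultimately show ?thesis by blast
  qed
  have "iterated_integral X [] = (\<lambda>_. 1)" by (simp add: fun_eq_iff)
  then have *: "holder (iterated_integral X w)" for w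
    by (induction w) (use Cons holder_const in \<open>auto simp del: iterated_integral.simps\<close>)
  show "holder (iterated_integral X w)" by (rule *)
  show "negligible (\<lambda>s t. iterated_integral X (i # w) t - iterated_integral X (i # w) s
       - iterated_integral X w s * (X t $ i - X s $ i))"
    using Cons * by blast
qed

text \<open>Evaluating an iterated integral is thereby reduced to guessing an
  antiderivative.\<close>

lemma iterated_integral_eqI:
  assumes "negligible (\<lambda>s t. F t - F s - iterated_integral X w s * (X t $ i - X s $ i))"
    and "0 \<le> t" "t \<le> T"
  shows "iterated_integral X (i # w) t = F t - F 0"
  using RS_integral_young[OF holder_iterated_integral holder_X continuous_X assms] by simp

lemma iterated_integral_Cons_0: "iterated_integral X (i # w) 0 = 0"
  using iterated_integral_eqI[OF negligible_iterated_integral, of 0] T_pos by simp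

lemma set_insertions_nonempty: "u \<in> set (insertions i w) \<Longrightarrow> u \<noteq> []"
  by (cases w) auto

text \<open>The shuffle identity for a letter and a word. By the product rule, the difference of the
  two sides has negligible increments, hence is constant, and it vanishes at time 0.\<close>

lemma increment_mult_iterated_integral:
  assumes "0 \<le> t" "t \<le> T"
  shows "(X t $ i - X 0 $ i) * iterated_integral X w t = (\<Sum>u\<leftarrow>insertions i w. iterated_integral X u t)"
  using assms
proof (induction w arbitrary: t)
  case Nil
  have "negligible (\<lambda>s t. X t $ i - X s $ i - iterated_integral X [] s * (X t $ i - X s $ i))"
    using negligible_0 by simp
  from iterated_integral_eqI[OF this Nil] show ?case by simp
next
  case (Cons j w)
  let ?I = "iterated_integral X"
  define \<Delta> where "\<Delta> t = X t $ i - X 0 $ i" for t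
  define G where "G t = \<Delta> t * ?I (j # w) t - (\<Sum>u\<leftarrow>insertions i (j # w). ?I u t)" for t
  have "holder \<Delta>" by (rule holder_cong[OF holder_X[of i], of _ "X 0 $ i"]) (simp add: \<Delta>_def)
  then obtain B where B: "\<And>t. t \<in> {0..T} \<Longrightarrow> \<bar>\<Delta> t\<bar> \<le> B" using holder_bounded by metis
  have "continuous_on {0..T} \<Delta>" unfolding \<Delta>_def by (intro continuous_intros continuous_X)
  \<comment> \<open>The increment of \<Delta> I(j # w) splits into a cross term (1), \<Delta> dI(j #
    w) (2) and I(j # w) dX^i. The last is the integral of the word \<open>i # j # w\<close> (3); by
    the induction hypothesis the second becomes the sum of the words starting with \<open>j\<close>
    (4).\<close>
  have 1: "negligible (\<lambda>s t. (?I (j # w) t - ?I (j # w) s) * (\<Delta> t - \<Delta> s))"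
    using \<open>holder \<Delta>\<close> \<open>continuous_on {0..T} \<Delta>\<close>
    by (intro negligible_product holder_iterated_integral)
  have 2: "negligible (\<lambda>s t. \<Delta> s * (?I (j # w) t - ?I (j # w) s - ?I w s * (X t $ j - X s $ j)))"
    using B by (rule negligible_mult_bounded[OF negligible_iterated_integral])
  have 3: "negligible (\<lambda>s t. ?I (i # j # w) t - ?I (i # j # w) s - ?I (j # w) s * (X t $ i - X s $ i))"
    by (rule negligible_iterated_integral)
  have 4: "negligible (\<lambda>s t. \<Sum>u\<leftarrow>insertions i w. ?I (j # u) t - ?I (j # u) s - ?I u s * (X t $ j - X s $ j))"
    by (intro negligible_sum_list negligible_iterated_integral)
  have "negligible (\<lambda>s t. G t - G s)"
  proof (rule negligible_cong[OF negligible_diff[OF negligible_diff[OF negligible_add[OF 1 2] 3] 4]])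
    fix s t assume st: "0 \<le> s" "s \<le> t" "t \<le> T"
    have IH: "\<Delta> s * ?I w s = (\<Sum>u\<leftarrow>insertions i w. ?I u s)"
      unfolding \<Delta>_def using st by (intro Cons.IH) auto
    have ins: "(\<Sum>u\<leftarrow>insertions i (j # w). ?I u t) = ?I (i # j # w) t + (\<Sum>u\<leftarrow>insertions i w. ?I (j # u) t)" for t
      by (simp add: o_def del: iterated_integral.simps)
    have ins': "(\<Sum>u\<leftarrow>insertions i w. ?I (j # u) t - ?I (j # u) s - ?I u s * (X t $ j - X s $ j))
        = (\<Sum>u\<leftarrow>insertions i w. ?I (j # u) t) - (\<Sum>u\<leftarrow>insertions i w. ?I (j # u) s)
          - \<Delta> s * ?I w s * (X t $ j - X s $ j)"
      unfolding IH by (simp only: sum_list_subtractf sum_list_mult_const)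
    have \<Delta>: "X t $ i - X s $ i = \<Delta> t - \<Delta> s" by (simp add: \<Delta>_def)
    show "G t - G s =
          (?I (j # w) t - ?I (j # w) s) * (\<Delta> t - \<Delta> s) +
          \<Delta> s * (?I (j # w) t - ?I (j # w) s - ?I w s * (X t $ j - X s $ j)) -
          (?I (i # j # w) t - ?I (i # j # w) s - ?I (j # w) s * (X t $ i - X s $ i)) -
          (\<Sum>u\<leftarrow>insertions i w. ?I (j # u) t - ?I (j # u) s - ?I u s * (X t $ j - X s $ j))"
      unfolding G_def ins ins' \<Delta> by (simp add: algebra_simps del: iterated_integral.simps)
  qed
  then have "G t = G 0" using Cons.prems by (rule negligible_increment_imp_const)
  \<comment> \<open>Inserted words are nonempty, so their integrals start at 0; the empty word would
    give 1.\<close>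
  moreover have "(\<Sum>u\<leftarrow>insertions i (j # w). ?I u 0) = 0"
  proof -
    have "?I u 0 = 0" if "u \<in> set (insertions i (j # w))" for u
      using set_insertions_nonempty[OF that]
      by (cases u) (auto simp: iterated_integral_Cons_0 simp del: iterated_integral.simps)
    then show ?thesis by (simp add: sum_list_eq_0_iff cong: map_cong del: insertions.simps iterated_integral.simps)
  qed
  then have "G 0 = 0" by (simp add: G_def \<Delta>_def)
  ultimately show ?case by (simp add: G_def \<Delta>_def del: iterated_integral.simps insertions.simps)
qed

end

text \<open>The control \<open>V t\<close> is the \<open>p\<close>-variation of \<open>X\<close> over \<open>[0,t]\<close> to the power \<open>p\<close>; it is
  superadditive in the interval, so that its increments dominate \<open>\<parallel>X t - X s\<parallel>\<^sup>p\<close>.\<close>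

lemma finite_p_variation_control:
  fixes X :: "real \<Rightarrow> 'a::real_normed_vector"
  assumes fin: "finite_p_variation p T X" and "0 < p"
  obtains V where "mono_on {0..T} V" "V ` {0..T} \<subseteq> {0..V T}"
    "\<And>s t. 0 \<le> s \<Longrightarrow> s \<le> t \<Longrightarrow> t \<le> T \<Longrightarrow> norm (X t - X s) powr p \<le> V t - V s"
proof -
  define S where "S P = (\<Sum>K\<in>P. norm (X (Sup K) - X (Inf K)) powr p)" for P
  define V where "V t = (SUP P\<in>{P. P division_of {0..t}}. S P)" for t
  have ext: "insert {s..t} P division_of {0..t} \<and> S (insert {s..t} P) = S P + norm (X t - X s) powr p"
    if P: "P division_of {0..s}" and st: "0 \<le> s" "s \<le> t" for P s t
  proof -
    have "P \<union> {{s..t}} division_of {0..s} \<union> {s..t}"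
      using st by (intro division_disjoint_union P) (auto simp: box_real division_of_def)
    moreover have "{0..s} \<union> {s..t} = {0..t}" using st by auto
    moreover have "S (insert {s..t} P) = S P + norm (X t - X s) powr p"
    \<comment> \<open>The new cell can already be a member only when s = t, and then its
      contribution is 0.\<close>
    proof (cases "{s..t} \<in> P")
      case True
      then have "t \<in> {0..s}" using st by (intro subsetD[OF division_ofD(2)[OF P]]) auto
      then have "s = t" using st by auto
      then show ?thesis using True \<open>0 < p\<close> by (simp add: insert_absorb)
    next
      case False
      then show ?thesis using division_ofD(1)[OF P] st by (simp add: S_def)
    qed
    ultimately show ?thesis by simp
  qed
  have nonempty: "\<exists>P. P division_of {0..t}" if "0 \<le> t" for t :: real
    using division_of_self[of 0 t] that by auto
  have bdd: "bdd_above (S ` {P. P division_of {0..t}})" if "0 \<le> t" "t \<le> T" for t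
  proof -
    obtain M where M: "\<And>P. P division_of {0..T} \<Longrightarrow> S P \<le> M"
      using fin unfolding finite_p_variation_def bdd_above_def S_def by auto
    \<comment> \<open>Adjoining the cell [t,T] extends a division of [0,t] to one of [0,T] without
      decreasing the sum.\<close>
    have "S P \<le> M" if "P division_of {0..t}" for P
    proof -
      have "S P \<le> S (insert {t..T} P)" using ext[OF that, of T] \<open>0 \<le> t\<close> \<open>t \<le> T\<close> by simp
      also have "\<dots> \<le> M" using ext[OF that, of T] \<open>0 \<le> t\<close> \<open>t \<le> T\<close> by (intro M) simp
      finally show ?thesis .
    qed
    then show ?thesis by (auto simp: bdd_above_def)
  qed
  have key: "norm (X t - X s) powr p \<le> V t - V s" if st: "0 \<le> s" "s \<le> t" "t \<le> T" for s t
  proof -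
    have "V s \<le> V t - norm (X t - X s) powr p"
      unfolding V_def[of s]
    proof (rule cSUP_least)
      fix P assume "P \<in> {P. P division_of {0..s}}"
      then have P: "insert {s..t} P division_of {0..t}" "S (insert {s..t} P) = S P + norm (X t - X s) powr p"
        using ext st by auto
      have "S (insert {s..t} P) \<le> V t"
        unfolding V_def using P(1) st by (intro cSUP_upper bdd) auto
      then show "S P \<le> V t - norm (X t - X s) powr p" using P(2) by simp
    qed (use nonempty[of s] st in auto)
    then show ?thesis by simp
  qed
  have le: "V s \<le> V t" if "0 \<le> s" "s \<le> t" "t \<le> T" for s t
    using order_trans[OF powr_ge_zero key[OF that]] by simp
  have "V 0 \<ge> 0" if "0 \<le> T"
  proof -
    obtain P where P: "P division_of {0..0::real}" using nonempty[of 0] by auto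
    have "0 \<le> S P" unfolding S_def by (intro sum_nonneg) auto
    also have "S P \<le> V 0" unfolding V_def using P that by (intro cSUP_upper bdd) auto
    finally show ?thesis .
  qed
  then have "V ` {0..T} \<subseteq> {0..V T}" using le by (force intro: order_trans)
  moreover have "mono_on {0..T} V" using le by (intro mono_onI) auto
  ultimately show ?thesis using key that by blast
qed

text \<open>Taking p-th roots in the bound by the p-variation gives the exponent 1/p, which exceeds
  1/2 because p < 2.\<close>

lemma paths_controlled:
  assumes "(T, X) \<in> paths"
  obtains \<alpha> V where "controlled_path T \<alpha> V X"
proof -
  obtain p where p: "1 \<le> p" "p < 2" "finite_p_variation p T X" and T: "0 < T" and cont: "continuous_on {0..T} X"
    using assms by (auto simp: paths_def)
  obtain W where W: "mono_on {0..T} W" "W ` {0..T} \<subseteq> {0..W T}"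
    "\<And>s t. 0 \<le> s \<Longrightarrow> s \<le> t \<Longrightarrow> t \<le> T \<Longrightarrow> norm (X t - X s) powr p \<le> W t - W s"
    using finite_p_variation_control[OF p(3)] p(1) by auto
  \<comment> \<open>Division by \<open>k\<close> brings the control into [0,1]; the summand 1 keeps
    \<open>k\<close> positive for constant paths.\<close>
  define k where "k = W T + 1"
  have "0 \<le> W T" using W(2) T by force
  then have k: "k > 0" "W T \<le> k" by (auto simp: k_def)
  define V where "V t = W t / k" for t
  interpret control T "1 / p" V
  proof
    show "mono_on {0..T} V"
      using k by (auto intro!: mono_onI divide_right_mono mono_onD[OF W(1)] simp: V_def)
    show "V ` {0..T} \<subseteq> {0..1}" using W(2) k by (fastforce simp: V_def divide_le_eq image_subset_iff)
  qed (use T p in \<open>auto simp: field_simps\<close>)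
  have "controlled_path T (1 / p) V X"
  proof
    fix i
    show "continuous_on {0..T} (\<lambda>s. X s $ i)" using cont by (intro continuous_intros)
    show "holder (\<lambda>s. X s $ i)"
      unfolding holder_def
    proof (intro exI[of _ "k powr (1 / p)"] conjI allI impI)
      fix s t assume st: "0 \<le> s" "s \<le> t" "t \<le> T"
      have "\<bar>X t $ i - X s $ i\<bar> \<le> norm (X t - X s)"
        using component_le_norm_cart[of "X t - X s" i] by simp
      also have "\<dots> = (norm (X t - X s) powr p) powr (1 / p)" using p by (simp add: powr_powr)
      also have "\<dots> \<le> (k * (V t - V s)) powr (1 / p)"
        using W(3)[OF st] k p by (intro powr_mono2) (auto simp: V_def right_diff_distrib)
      also have "\<dots> = k powr (1 / p) * (V t - V s) powr (1 / p)"
        using k dV(1)[OF st] by (simp add: powr_mult)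
      finally show "\<bar>X t $ i - X s $ i\<bar> \<le> k powr (1 / p) * (V t - V s) powr (1 / p)" .
    qed simp
  qed
  then show ?thesis by (rule that)
qed

section \<open>Linear paths\<close>

definition linear_path :: "real ^ 'd \<Rightarrow> ('d::finite) path" where
  "linear_path v = (1, restrict (\<lambda>t. t *\<^sub>R v) {0..1})"

text \<open>With p = 1, each cell contributes its length times the norm of \<open>v\<close>, and the
  lengths in a division of [0,1] sum to 1.\<close>

lemma linear_path_in_paths: "linear_path v \<in> paths"
proof -
  let ?X = "restrict (\<lambda>t. t *\<^sub>R v) {0..1}"
  have "continuous_on {0..1} ?X"
    by (rule continuous_on_eq[of _ "\<lambda>t. t *\<^sub>R v"]) (auto intro!: continuous_intros)
  moreover have "finite_p_variation 1 1 ?X"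
    unfolding finite_p_variation_def bdd_above_def
  proof (intro exI[of _ "norm v"] ballI)
    fix y assume "y \<in> (\<lambda>P. \<Sum>K\<in>P. norm (?X (Sup K) - ?X (Inf K)) powr 1) ` {P. P division_of {0..1}}"
    then obtain P where P: "P division_of {0..1}"
      and y: "y = (\<Sum>K\<in>P. norm (?X (Sup K) - ?X (Inf K)) powr 1)" by auto
    have "norm (?X (Sup K) - ?X (Inf K)) powr 1 = norm v * measure lborel K" if K: "K \<in> P" for K
    proof -
      obtain a b where ab: "K = {a..b}" using division_ofD(4)[OF P K] by auto
      then have "a \<le> b" using division_ofD(3)[OF P K] by auto
      moreover have "a \<in> {0..1}" "b \<in> {0..1}"
        using \<open>a \<le> b\<close> ab by (auto intro!: subsetD[OF division_ofD(2)[OF P K]] simp del: atLeastAtMost_iff) auto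
      ultimately show ?thesis
        by (simp add: ab scaleR_diff_left[symmetric])
    qed
    then have "y = norm v * (\<Sum>K\<in>P. measure lborel K)" by (simp add: y sum_distrib_left)
    also have "(\<Sum>K\<in>P. measure lborel K) = 1"
      using additive_content_division[of P 0 1] P by simp
    finally show "y \<le> norm v" by simp
  qed
  ultimately show ?thesis by (auto simp: linear_path_def paths_def intro!: exI[of _ 1])
qed

text \<open>With control t and exponent 1, the integral up to time t is t^n/n! times the product of
  the components, by induction on the word. Reversing the word does not affect this product.\<close>

lemma signature_linear_path: "signature (linear_path v) w = (\<Prod>i\<leftarrow>w. v $ i) / fact (length w)"
proof -
  let ?X = "restrict (\<lambda>t. t *\<^sub>R v) {0..1}"
  interpret control 1 1 "\<lambda>t. t"
    by standard (auto intro: mono_onI)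
  have lin: "?X t $ i = t * v $ i" if "0 \<le> t" "t \<le> 1" for t i using that by simp
  interpret controlled_path 1 1 "\<lambda>t. t" ?X
  proof
    fix i
    show "holder (\<lambda>s. ?X s $ i)"
      unfolding holder_def
      by (intro exI[of _ "\<bar>v $ i\<bar>"]) (auto simp: abs_mult simp flip: left_diff_distrib)
    show "continuous_on {0..1} (\<lambda>s. ?X s $ i)"
      by (rule continuous_on_eq[of _ "\<lambda>t. t * v $ i"]) (auto intro!: continuous_intros)
  qed
  have pow: "holder (\<lambda>t. t ^ n)" for n
    unfolding holder_def
  proof (intro exI[of _ "real n"] conjI allI impI)
    fix s t :: real assume "0 \<le> s" "s \<le> t" "t \<le> 1"
    then show "\<bar>t ^ n - s ^ n\<bar> \<le> real n * (t - s) powr 1"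
      using norm_power_diff[of t s n] by simp
  qed simp
  have ident: "holder (\<lambda>t. t)" using pow[of 1] by simp
  \<comment> \<open>The rule d(t^(n+1)) = (n+1) t^n dt modulo negligible functions; the induction
    writes t^(n+2) as t times t^(n+1) and uses the product rule.\<close>
  have deriv: "negligible (\<lambda>s t. t ^ Suc n - s ^ Suc n - real (Suc n) * s ^ n * (t - s))" for n
  proof (induction n)
    case 0
    then show ?case using negligible_0 by simp
  next
    case (Suc n)
    have "negligible (\<lambda>s t. (t - s) * (t ^ Suc n - s ^ Suc n))"
      by (intro negligible_product ident pow continuous_intros)
    moreover have "negligible (\<lambda>s t. s * (t ^ Suc n - s ^ Suc n - real (Suc n) * s ^ n * (t - s)))"
      by (rule negligible_mult_bounded[OF Suc, of _ 1]) auto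
    ultimately have "negligible (\<lambda>s t. (t - s) * (t ^ Suc n - s ^ Suc n) +
        s * (t ^ Suc n - s ^ Suc n - real (Suc n) * s ^ n * (t - s)))"
      by (rule negligible_add)
    then show ?case by (rule negligible_cong) (simp add: algebra_simps)
  qed
  have "iterated_integral ?X w t = t ^ length w * ((\<Prod>i\<leftarrow>w. v $ i) / fact (length w))"
    if "0 \<le> t" "t \<le> 1" for w t
    using that
  proof (induction w arbitrary: t)
    case (Cons i w)
    define n where "n = length w"
    define c where "c = (\<Prod>i\<leftarrow>i # w. v $ i) / fact (Suc n)"
    have "negligible (\<lambda>s t. c * (t ^ Suc n - s ^ Suc n - real (Suc n) * s ^ n * (t - s)))"
      using negligible_mult_bounded[OF deriv, of "\<lambda>_. c" "\<bar>c\<bar>"] by simp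
    then have "negligible (\<lambda>s t. t ^ Suc n * c - s ^ Suc n * c - iterated_integral ?X w s * (?X t $ i - ?X s $ i))"
    proof (rule negligible_cong)
      fix s t :: real assume st: "0 \<le> s" "s \<le> t" "t \<le> 1"
      have "iterated_integral ?X w s * v $ i = real (Suc n) * s ^ n * c"
        by (subst Cons.IH) (use st in \<open>simp_all add: c_def n_def field_simps del: of_nat_Suc\<close>)
      then have "iterated_integral ?X w s * (?X t $ i - ?X s $ i) = real (Suc n) * s ^ n * c * (t - s)"
        using lin[of t i] lin[of s i] st by (simp add: mult.assoc flip: left_diff_distrib)
      then show "t ^ Suc n * c - s ^ Suc n * c - iterated_integral ?X w s * (?X t $ i - ?X s $ i)
          = c * (t ^ Suc n - s ^ Suc n - real (Suc n) * s ^ n * (t - s))"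
        by (simp add: algebra_simps)
    qed
    from iterated_integral_eqI[OF this Cons.prems]
    have "iterated_integral ?X (i # w) t = t ^ Suc n * c - 0 ^ Suc n * c" .
    also have "\<dots> = t ^ length (i # w) * ((\<Prod>i\<leftarrow>i # w. v $ i) / fact (length (i # w)))"
      by (simp add: c_def n_def)
    finally show ?case .
  qed simp
  from this[of 1 "rev w"] show ?thesis
    by (simp add: linear_path_def rev_map[symmetric])
qed

section \<open>Tensors and polynomials\<close>

text \<open>Cancellation may remove keys, but only terms with coefficient 0 are lost. The key type
  and weight are arbitrary, so that both \<open>pairing\<close> and \<open>mpoly_eval\<close> are
  covered.\<close>

lemma sum_keys_add:
  fixes x y :: "'a \<Rightarrow>\<^sub>0 real"
  shows "(\<Sum>w\<in>Poly_Mapping.keys (x + y). Poly_Mapping.lookup (x + y) w * a w)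
    = (\<Sum>w\<in>Poly_Mapping.keys x. Poly_Mapping.lookup x w * a w)
      + (\<Sum>w\<in>Poly_Mapping.keys y. Poly_Mapping.lookup y w * a w)"
  by (rule setsum_keys_plus_distrib) (auto simp: distrib_right)

lemma sum_keys_single:
  "(\<Sum>w\<in>Poly_Mapping.keys (Poly_Mapping.single u (c::real)). Poly_Mapping.lookup (Poly_Mapping.single u c) w * a w) = c * a u"
  by simp

text \<open>Closure properties are proved for functions on paths instead of tensors; this takes the
  place of a shuffle product on tensors.\<close>

definition tensor_function :: "(('d::finite) path \<Rightarrow> real) \<Rightarrow> bool" where
  "tensor_function \<phi> \<longleftrightarrow> (\<exists>x. \<forall>X\<in>paths. \<phi> X = pairing (signature X) x)"

lemma tensor_function_cong:
  assumes "tensor_function \<phi>" "\<And>X. X \<in> paths \<Longrightarrow> \<psi> X = \<phi> X"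
  shows "tensor_function \<psi>"
  using assms by (simp add: tensor_function_def)

lemma tensor_function_word: "tensor_function (\<lambda>X. c * signature X w)"
  unfolding tensor_function_def pairing_def
  by (intro exI[of _ "Poly_Mapping.single w c"] ballI) (simp only: sum_keys_single)

lemma tensor_function_add:
  assumes "tensor_function \<phi>" "tensor_function \<psi>"
  shows "tensor_function (\<lambda>X. \<phi> X + \<psi> X)"
proof -
  obtain x y where "\<forall>X\<in>paths. \<phi> X = pairing (signature X) x" "\<forall>X\<in>paths. \<psi> X = pairing (signature X) y"
    using assms unfolding tensor_function_def by blast
  then show ?thesis
    unfolding tensor_function_def by (intro exI[of _ "x + y"]) (simp add: pairing_def sum_keys_add)
qed

lemma tensor_function_0: "tensor_function (\<lambda>X. 0)"
  using tensor_function_word[of 0] by simp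

lemma tensor_function_sum:
  assumes "\<And>i. i \<in> I \<Longrightarrow> tensor_function (\<phi> i)"
  shows "tensor_function (\<lambda>X. \<Sum>i\<in>I. \<phi> i X)"
  using assms
  by (induction I rule: infinite_finite_induct) (auto intro: tensor_function_0 tensor_function_add)

lemma tensor_function_sum_list:
  assumes "\<And>i. i \<in> set us \<Longrightarrow> tensor_function (\<phi> i)"
  shows "tensor_function (\<lambda>X. \<Sum>i\<leftarrow>us. \<phi> i X)"
  using assms by (induction us) (auto intro: tensor_function_0 tensor_function_add)

section \<open>Multiplication by components of the increment\<close>

definition increment :: "('d::finite) path \<Rightarrow> real ^ 'd" where
  "increment P = snd P (fst P) - snd P 0"

text \<open>The reversals arise because \<open>signature\<close> reads a word from the innermost
  integration, whereas \<open>insertions\<close> is matched to lists headed by the outermost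
  letter.\<close>

lemma increment_mult_signature:
  assumes "P \<in> paths"
  shows "increment P $ i * signature P w = (\<Sum>u\<leftarrow>insertions i (rev w). signature P (rev u))"
proof -
  obtain T X where P: "P = (T, X)" by (cases P)
  obtain \<alpha> V where "controlled_path T \<alpha> V X" using paths_controlled assms P by blast
  then interpret controlled_path T \<alpha> V X .
  show ?thesis
    using increment_mult_iterated_integral[of T i "rev w"] T_pos by (simp add: P increment_def)
qed

lemma tensor_function_increment_mult:
  assumes "tensor_function \<phi>"
  shows "tensor_function (\<lambda>X. increment X $ i * \<phi> X)"
proof -
  obtain x where x: "\<forall>X\<in>paths. \<phi> X = pairing (signature X) x"
    using assms unfolding tensor_function_def by blast
  let ?\<psi> = "\<lambda>X. \<Sum>w\<in>Poly_Mapping.keys x. \<Sum>u\<leftarrow>insertions i (rev w). Poly_Mapping.lookup x w * signature X (rev u)"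
  have "tensor_function ?\<psi>"
    by (intro tensor_function_sum tensor_function_sum_list tensor_function_word)
  then show ?thesis
  proof (rule tensor_function_cong)
    fix X :: "'a path" assume X: "X \<in> paths"
    have "?\<psi> X = (\<Sum>w\<in>Poly_Mapping.keys x. Poly_Mapping.lookup x w * (increment X $ i * signature X w))"
      by (simp only: increment_mult_signature[OF X] sum_list_const_mult)
    also have "\<dots> = increment X $ i * \<phi> X"
      using X x by (simp add: pairing_def sum_distrib_left mult_ac)
    finally show "increment X $ i * \<phi> X = ?\<psi> X" ..
  qed
qed

text \<open>A monomial is built from its coefficient, a multiple of the empty word, by multiplying
  with one component at a time: the outer induction runs over the variables, the inner one over the
  exponent.\<close>

lemma tensor_function_mpoly_eval: "tensor_function (\<lambda>X. mpoly_eval f (increment X))"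
proof -
  have "tensor_function (\<lambda>X. (\<Prod>i\<in>I. increment X $ i ^ k i) * c)" for I k c
  proof (induction I rule: infinite_finite_induct)
    case (insert i I)
    have "tensor_function (\<lambda>X. increment X $ i ^ n * ((\<Prod>i\<in>I. increment X $ i ^ k i) * c))" for n
    proof (induction n)
      case (Suc n)
      then show ?case using tensor_function_increment_mult[OF Suc, of i] by (simp add: mult_ac)
    qed (use insert in simp)
    then show ?case using insert by (simp add: mult_ac)
  qed (use tensor_function_word[of c "[]"] in \<open>auto elim: tensor_function_cong\<close>)
  then show ?thesis
    unfolding mpoly_eval_def by (subst mult.commute) (intro tensor_function_sum)
qed

section \<open>Polynomial maps\<close>

definition polynomial_map :: "(real ^ 'd::finite \<Rightarrow> real) \<Rightarrow> bool" where
  "polynomial_map \<phi> \<longleftrightarrow> (\<exists>f. \<forall>v. \<phi> v = mpoly_eval f v)"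

lemma polynomial_map_add:
  assumes "polynomial_map \<phi>" "polynomial_map \<psi>"
  shows "polynomial_map (\<lambda>v. \<phi> v + \<psi> v)"
proof -
  obtain f g where "\<forall>v. \<phi> v = mpoly_eval f v" "\<forall>v. \<psi> v = mpoly_eval g v"
    using assms unfolding polynomial_map_def by blast
  then show ?thesis
    unfolding polynomial_map_def by (intro exI[of _ "f + g"]) (simp add: mpoly_eval_def sum_keys_add)
qed

text \<open>The exponent vector counts the occurrences of each letter in the word.\<close>

lemma polynomial_map_word: "polynomial_map (\<lambda>v. c * (\<Prod>i\<leftarrow>w. v $ i))"
proof -
  have "\<exists>m. \<forall>v::real ^ 'a. (\<Prod>i\<leftarrow>w. v $ i) = (\<Prod>i\<in>UNIV. v $ i ^ Poly_Mapping.lookup m i)"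
  proof (induction w)
    case (Cons j w)
    then obtain m where m: "\<forall>v::real ^ 'a. (\<Prod>i\<leftarrow>w. v $ i) = (\<Prod>i\<in>UNIV. v $ i ^ Poly_Mapping.lookup m i)" ..
    have "v $ j = (\<Prod>i\<in>UNIV. v $ i ^ Poly_Mapping.lookup (Poly_Mapping.single j 1) i)" for v :: "real ^ 'a"
      by (simp add: lookup_single when_def if_distrib[of "\<lambda>n. _ ^ n"] cong: if_cong)
    then show ?case using m
      by (intro exI[of _ "Poly_Mapping.single j 1 + m"]) (simp add: lookup_add power_add prod.distrib)
  qed (auto intro: exI[of _ 0])
  then obtain m where "\<forall>v::real ^ 'a. (\<Prod>i\<leftarrow>w. v $ i) = (\<Prod>i\<in>UNIV. v $ i ^ Poly_Mapping.lookup m i)" ..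
  then show ?thesis
    unfolding polynomial_map_def mpoly_eval_def
    by (intro exI[of _ "Poly_Mapping.single m c"]) (simp only: sum_keys_single simp_thms)
qed

lemma polynomial_map_sum:
  assumes "\<And>i. i \<in> I \<Longrightarrow> polynomial_map (\<phi> i)"
  shows "polynomial_map (\<lambda>v. \<Sum>i\<in>I. \<phi> i v)"
  using assms
proof (induction I rule: infinite_finite_induct)
  case (insert i I)
  then show ?case by (auto intro: polynomial_map_add)
qed (use polynomial_map_word[of 0 "[]"] in auto)

lemma polynomial_map_pairing_linear_path: "polynomial_map (\<lambda>v. pairing (signature (linear_path v)) x)"
proof -
  have "polynomial_map (\<lambda>v. \<Sum>w\<in>Poly_Mapping.keys x. Poly_Mapping.lookup x w / fact (length w) * (\<Prod>i\<leftarrow>w. v $ i))"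
    by (intro polynomial_map_sum polynomial_map_word)
  then show ?thesis by (simp add: pairing_def signature_linear_path)
qed

section \<open>The two directions of the equivalence\<close>

lemma paths_with_increment_in_iff: "P \<in> paths_with_increment_in M \<longleftrightarrow> P \<in> paths \<and> increment P \<in> M"
  by (cases P) (simp add: paths_with_increment_in_def increment_def)

theorem theorem1p1:
  fixes M :: "(real ^ 'd::finite) set"
  shows "path_variety (paths_with_increment_in M) \<longleftrightarrow> point_variety M"
proof
  assume "path_variety (paths_with_increment_in M)"
  then obtain W where W: "paths_with_increment_in M = path_zero_set W"
    by (auto simp: path_variety_def)
  have "\<forall>x::'d tensor. \<exists>f. \<forall>v. pairing (signature (linear_path v)) x = mpoly_eval f v"
    using polynomial_map_pairing_linear_path by (auto simp: polynomial_map_def)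
  \<comment> \<open>One polynomial per tensor, independent of \<open>v\<close>; those belonging to
    \<open>W\<close> will cut out M.\<close>
  then obtain q where q: "\<And>(x::'d tensor) v. pairing (signature (linear_path v)) x = mpoly_eval (q x) v"
    by metis
  have "v \<in> M \<longleftrightarrow> (\<forall>f\<in>q ` W. mpoly_eval f v = 0)" for v
  proof -
    \<comment> \<open>The linear path realises \<open>v\<close> as an increment, so membership in M
      can be tested on this single path.\<close>
    have "v \<in> M \<longleftrightarrow> linear_path v \<in> paths_with_increment_in M"
      using linear_path_in_paths[of v]
      by (simp add: paths_with_increment_in_iff) (simp add: increment_def linear_path_def)
    also have "\<dots> \<longleftrightarrow> (\<forall>x\<in>W. pairing (signature (linear_path v)) x = 0)"
      using linear_path_in_paths[of v] by (simp add: W path_zero_set_def)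
    finally show ?thesis by (simp add: q)
  qed
  then show "point_variety M" unfolding point_variety_def by blast
next
  assume "point_variety M"
  then obtain F where F: "M = {v. \<forall>f\<in>F. mpoly_eval f v = 0}" by (auto simp: point_variety_def)
  have "\<forall>f. \<exists>x. \<forall>X\<in>paths. mpoly_eval f (increment X) = pairing (signature (X::'d path)) x"
    using tensor_function_mpoly_eval by (auto simp: tensor_function_def)
  \<comment> \<open>One tensor per polynomial, valid for all paths at once, so the two systems of
    equations agree path by path.\<close>
  then obtain x where x: "\<And>f (X::'d path). X \<in> paths \<Longrightarrow> mpoly_eval f (increment X) = pairing (signature X) (x f)"
    by metis
  have "paths_with_increment_in M = path_zero_set (x ` F)"
    by (auto simp: paths_with_increment_in_iff path_zero_set_def F x)
  then show "path_variety (paths_with_increment_in M)" unfolding path_variety_def by blast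
qed

end
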